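(* Let $K:SO(3)\times SO(3)\to\mathbb{R}$ be of the form $K(R,Q)=g(d(R,Q)^2)$ with $g:[0,\infty)\to\mathbb{R}$ differentiable with locally Lipschitz continuous derivative, and $g'\ge 0$. Suppose that $\rho_0\in\mathcal{P}(\mathcal{D}_\varepsilon)$ satisfies $\mathrm{supp}(\rho_0)\subset\overline{D}_r$ for some $r<\pi/2-\varepsilon$. Then there exists a unique global weak solution in $\mathrm{C}([0,\infty);\mathcal{P}(\mathcal{D}_\varepsilon))$ to the aggregation model $\partial_t\rho+\nabla\cdot(\rho v)=0$, $v=-\nabla K*\rho$, that starts from $\rho_0$; moreover, $\mathrm{supp}(\rho_t)\subset\overline{D}_r$ for all $t\in[0,\infty)$.
   Context: $SO(3)$ is the group of $3\times3$ rotation matrices, with $T_RSO(3)=\{RA: A\in\mathbb{R}^{3\times3},\ A^T=-A\}$ and Riemannian metric $RA_1\cdot RA_2=\frac12\langle A_1,A_2\rangle_F$ ($\langle\cdot,\cdot\rangle_F$ is the Frobenius inner product). $d$ is the geodesic distance, $d(R,Q)=\arccos\big(\frac{\mathrm{tr}(R^TQ)-1}{2}\big)$, and $\nabla$ is the Riemannian gradient on $SO(3)$. For $r\in(0,\pi/2)$, $D_r=\{Q\in SO(3): d(I,Q)<r\}$ and $\overline{D}_r$ is its closure. Fix $\varepsilon\in(0,\pi/2)$ (arbitrarily small) and let $\mathcal{D}_\varepsilon=D_{\frac{\pi}{2}-\varepsilon}$. $\mathcal{P}(\mathcal{D}_\varepsilon)$ is the set of Borel probability measures on $\mathcal{D}_\varepsilon$;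 $\mathrm{C}([0,T);\mathcal{P}(\mathcal{D}_\varepsilon))$ is the set of curves $[0,T)\to\mathcal{P}(\mathcal{D}_\varepsilon)$ that are continuous for the narrow topology (convergence against bounded continuous functions). Write $K_Q(R)=K(R,Q)$. For a curve $\rho=(\rho_t)$ in $\mathcal{P}(\mathcal{D}_\varepsilon)$ the velocity field is $v[\rho](R,t)=-\int_{\mathcal{D}_\varepsilon}\nabla K_Q(R)\,d\rho_t(Q)$, $R\in\mathcal{D}_\varepsilon$ (gradient in the variable $R$). For $\Sigma\subset\mathcal{D}_\varepsilon$ and a time-dependent tangent vector field $X$ on $\mathcal{D}_\varepsilon$, a flow map generated by $(X,\Sigma)$ on $[0,\tau)$ is a map $\Psi_X:\Sigma\times[0,\tau)\to\mathcal{D}_\varepsilon$ with $\frac{d}{dt}\Psi_X^t(R)=X_t(\Psi_X^t(R))$, $\Psi_X^0(R)=R$. Weak solution on $[0,T)$, $T\in(0,\infty]$: $(\rho_t)_{t\in[0,T)}\subset\mathcal{P}(\mathcal{D}_\varepsilon)$ is a weak solution starting from $\rho_0$ if $v[\rho]$ generates a unique flow map $\Psi_{v[\rho]}$ defined on $\mathrm{supp}(\rho_0)\times[0,T)$ and $\rho_t=\Psi^t_{v[\rho]}\#\rho_0$ (push-forward) for all $t\in[0,T)$; it is global if $T=\infty$. *)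

theory Defs
  imports "HOL-Probability.Probability"
begin

section \<open>Riemannian structure of the rotation group\<close>

definition SO3 :: "(real^3^3) set" where
  "SO3 = {R. rotation_matrix R}"

definition tangent_SO3 :: "real^3^3 \<Rightarrow> (real^3^3) set" where
  "tangent_SO3 R = {R ** A | A. transpose A = - A}"

text \<open>The inner product of \<open>real^3^3\<close> is the Frobenius inner product, and
  \<open>transpose R ** V\<close> is the skew matrix \<open>A\<close> of a tangent vector \<open>V = R ** A\<close>.\<close>

definition metric_SO3 :: "real^3^3 \<Rightarrow> real^3^3 \<Rightarrow> real^3^3 \<Rightarrow> real" where
  "metric_SO3 R V W = (1/2) * ((transpose R ** V) \<bullet> (transpose R ** W))"

definition geodist :: "real^3^3 \<Rightarrow> real^3^3 \<Rightarrow> real" where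
  "geodist R Q = arccos ((trace (transpose R ** Q) - 1) / 2)"

definition geoball :: "real \<Rightarrow> (real^3^3) set" where
  "geoball r = {Q \<in> SO3. geodist (mat 1) Q < r}"

text \<open>Only the values of \<open>f\<close> on \<open>SO3\<close> matter: the derivative is taken within \<open>SO3\<close>, and
  of \<open>D\<close>, whose extension to the normal directions is arbitrary, only the restriction to the
  tangent space (the differential of \<open>f\<close>) is used.\<close>

definition is_grad_SO3 :: "(real^3^3 \<Rightarrow> real) \<Rightarrow> real^3^3 \<Rightarrow> real^3^3 \<Rightarrow> bool" where
  "is_grad_SO3 f R G \<longleftrightarrow> G \<in> tangent_SO3 R \<and>
     (\<exists>D. (f has_derivative D) (at R within SO3) \<and>
          (\<forall>V \<in> tangent_SO3 R. metric_SO3 R G V = D V))"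

definition grad_SO3 :: "(real^3^3 \<Rightarrow> real) \<Rightarrow> real^3^3 \<Rightarrow> real^3^3" where
  "grad_SO3 f R = (THE G. is_grad_SO3 f R G)"


section \<open>Probability measures on a subset of the rotation group\<close>

definition prob_measures :: "(real^3^3) set \<Rightarrow> (real^3^3) measure set" where
  "prob_measures U = {\<mu>. sets \<mu> = sets (restrict_space borel U) \<and> prob_space \<mu>}"

text \<open>Topological support, relative to the space on which the measure lives.\<close>

definition msupp :: "(real^3^3) measure \<Rightarrow> (real^3^3) set" where
  "msupp \<mu> = {x \<in> space \<mu>. \<forall>V. open V \<and> x \<in> V \<longrightarrow> emeasure \<mu> (V \<inter> space \<mu>) > 0}"

definition time_interval :: "ereal \<Rightarrow> real set" where
  "time_interval T = {t. 0 \<le> t \<and> ereal t < T}"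

text \<open>\<open>C([0,T); P(U))\<close>. The narrow topology is the initial topology of the maps
  \<open>\<mu> \<mapsto> integral of f against \<mu>\<close> with \<open>f\<close> bounded and continuous on \<open>U\<close>, so a curve is
  continuous iff its composition with each of these maps is.\<close>

definition narrow_curves ::
    "ereal \<Rightarrow> (real^3^3) set \<Rightarrow> (real \<Rightarrow> (real^3^3) measure) set" where
  "narrow_curves T U = {\<rho>. (\<forall>t \<in> time_interval T. \<rho> t \<in> prob_measures U) \<and>
     (\<forall>f :: real^3^3 \<Rightarrow> real. continuous_on U f \<and> bounded (f ` U) \<longrightarrow>
        continuous_on (time_interval T) (\<lambda>t. integral\<^sup>L (\<rho> t) f))}"


section \<open>The aggregation model\<close>

definition velocity ::
    "(real^3^3 \<Rightarrow> real^3^3 \<Rightarrow> real) \<Rightarrow> (real \<Rightarrow> (real^3^3) measure)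
       \<Rightarrow> real \<Rightarrow> real^3^3 \<Rightarrow> real^3^3" where
  "velocity K \<rho> t R = - (LINT Q|\<rho> t. grad_SO3 (\<lambda>R'. K R' Q) R)"

text \<open>\<open>\<Psi> t R\<close> is only meaningful for \<open>R \<in> \<Sigma>\<close> and \<open>t \<in> [0,\<tau>)\<close>; the derivative at \<open>t = 0\<close> is
  one-sided.\<close>

definition is_flow_map ::
    "(real^3^3) set \<Rightarrow> (real \<Rightarrow> real^3^3 \<Rightarrow> real^3^3) \<Rightarrow> (real^3^3) set \<Rightarrow> ereal
       \<Rightarrow> (real \<Rightarrow> real^3^3 \<Rightarrow> real^3^3) \<Rightarrow> bool" where
  "is_flow_map U X \<Sigma> \<tau> \<Psi> \<longleftrightarrow>
     (\<forall>R \<in> \<Sigma>. \<Psi> 0 R = R \<and>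
       (\<forall>t \<in> time_interval \<tau>. \<Psi> t R \<in> U \<and>
          ((\<lambda>s. \<Psi> s R) has_vector_derivative X t (\<Psi> t R)) (at t within time_interval \<tau>)))"

text \<open>The flow map is defined on the support of \<open>\<rho>0\<close> only, so \<open>\<rho>0\<close> is restricted to
  its support (a set of full measure) before it is pushed forward.\<close>

definition weak_solution ::
    "(real^3^3 \<Rightarrow> real^3^3 \<Rightarrow> real) \<Rightarrow> (real^3^3) set \<Rightarrow> ereal \<Rightarrow> (real^3^3) measure
       \<Rightarrow> (real \<Rightarrow> (real^3^3) measure) \<Rightarrow> bool" where
  "weak_solution K U T \<rho>0 \<rho> \<longleftrightarrow>
     (\<forall>t \<in> time_interval T. \<rho> t \<in> prob_measures U) \<and>
     (\<exists>\<Psi>. is_flow_map U (velocity K \<rho>) (msupp \<rho>0) T \<Psi> \<and>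
        (\<forall>\<Phi>. is_flow_map U (velocity K \<rho>) (msupp \<rho>0) T \<Phi> \<longrightarrow>
           (\<forall>t \<in> time_interval T. \<forall>R \<in> msupp \<rho>0. \<Phi> t R = \<Psi> t R)) \<and>
        (\<forall>t \<in> time_interval T.
           \<Psi> t \<in> measurable (restrict_space \<rho>0 (msupp \<rho>0)) (restrict_space borel U) \<and>
           \<rho> t = distr (restrict_space \<rho>0 (msupp \<rho>0)) (restrict_space borel U) (\<Psi> t)))"

end

theory Submission
  imports Defs
begin

text \<open>On \<open>SO3\<close> the distance of \<open>R\<close> and \<open>Q\<close> is a function of the Frobenius product \<open>R \<bullet> Q\<close>, so
\<open>K R Q = h (R \<bullet> Q)\<close>, and away from the cut locus \<open>R \<bullet> Q = - 1\<close> the negative gradient of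
\<open>K\<close> in \<open>R\<close> is \<open>c (R \<bullet> Q) *\<^sub>R (Q - R ** transpose Q ** R)\<close> with \<open>c = - h'\<close>. If \<open>\<theta>\<close> is the distance,
\<open>c = g' (\<theta>\<^sup>2) * \<theta> / sin \<theta>\<close>, which is nonnegative and Lipschitz up to and including \<open>\<theta> = 0\<close>. Two points of
the ball of radius \<open>pi / 2 - \<epsilon>\<close> stay at a positive distance from the cut locus, so on
this ball the interaction is bounded and Lipschitz.

A weak solution is the push-forward of its initial measure \<open>\<mu>\<close> (restricted to its support) under
its own flow. The flow therefore solves, for all starting points \<open>R\<close> in the support at once, the coupled system
\<open>d/dt \<Psi> t R = integral of F (\<Psi> t R) (\<Psi> t S) d\<mu>(S)\<close>, where \<open>F\<close> is the interaction. Conversely, a flow of this system that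
stays in the ball gives a weak solution, so that the theorem is about this system only.

Existence: \<open>F\<close> is extended to a bounded, globally Lipschitz function of all pairs of matrices, and
the system becomes a Lipschitz differential equation in the Banach space of bounded
continuous functions of \<open>R\<close>, which has a global solution (\<open>mean_field_flow_exists\<close>). The
extension has the form \<open>A ** W\<close> with \<open>W\<close> skew, up to a scalar factor, and so it preserves \<open>SO3\<close> (\<open>SO3_invariant\<close>).

Invariance of the closed ball of radius \<open>r\<close>: this ball is the set of rotations with trace at least
\<open>k = 1 + 2 * cos r\<close>. In Rodrigues parameters the trace of the interaction can be computed, and
it turns out that a particle is pulled outwards at most in proportion to the amount by which another
particle is farther out (\<open>trace_attraction_lower_bound\<close>). So if all
traces are at least \<open>k - B\<close> then none below \<open>k\<close> decreases faster than at rate \<open>C * B\<close>, and a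
Gronwall argument for the whole family shows that no trace falls below \<open>k\<close> (\<open>family_barrier\<close>). The same
lemma, applied to minus the squared distance of two flows, gives uniqueness.\<close>

section \<open>Global solutions of Lipschitz differential equations\<close>

text \<open>The solution is the limit of the Picard iterates; the \<open>n\<close>-th increment is at most
\<open>norm (f x0) * L ^ n * t ^ (n + 1) / fact (n + 1)\<close>, so they converge uniformly on every bounded interval.\<close>

lemma lipschitz_ode_exists:
  fixes f :: "'a::banach \<Rightarrow> 'a"
  assumes lip: "\<And>x y. norm (f x - f y) \<le> L * norm (x - y)" and L: "0 \<le> L"
  shows "\<exists>u. u 0 = x0 \<and> (\<forall>t\<ge>0. (u has_vector_derivative f (u t)) (at t within {0..}))"
proof -
  define u :: "nat \<Rightarrow> real \<Rightarrow> 'a" where "u n = ((\<lambda>v t. x0 + integral {0..t} (\<lambda>s. f (v s))) ^^ n) (\<lambda>_. x0)" for n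
  have u0: "u 0 = (\<lambda>_. x0)" by (simp add: u_def)
  have uS: "u (Suc n) t = x0 + integral {0..t} (\<lambda>s. f (u n s))" for n t
    by (simp add: u_def)
  have fcont: "continuous_on UNIV f"
  proof -
    have "L-lipschitz_on UNIV f" using lip L by (auto intro!: lipschitz_onI simp: dist_norm)
    then show ?thesis by (rule lipschitz_on_continuous_on)
  qed
  have fc: "continuous_on S (\<lambda>t. f (v t))" if "continuous_on S v" for S :: "real set" and v
    using continuous_on_compose2[OF fcont that] by auto
  have int_deriv: "((\<lambda>t. x0 + integral {0..t} (\<lambda>s. f (v s))) has_vector_derivative f (v t))
      (at t within {0..T})"
    if "continuous_on {0..T} v" "t \<in> {0..T}" for v T t
    using integral_has_vector_derivative[OF fc[OF that(1)] that(2)]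
    by (auto intro!: derivative_eq_intros)
  have ucont: "continuous_on {0..T} (u n)" for n T
  proof (induction n)
    case 0 then show ?case by (simp add: u0)
  next
    case (Suc n)
    have "u (Suc n) = (\<lambda>t. x0 + integral {0..t} (\<lambda>s. f (u n s)))" by (auto simp: uS)
    then show ?case
      using int_deriv[OF Suc] unfolding continuous_on_eq_continuous_within
      by (metis has_vector_derivative_continuous)
  qed
  define M where "M = norm (f x0)"
  have bound: "norm (u (Suc n) t - u n t) \<le> M * L ^ n * t ^ Suc n / fact (Suc n)"
    if "0 \<le> t" for n t
    using that
  proof (induction n arbitrary: t)
    case 0
    then show ?case
      by (simp add: uS u0 M_def mult.commute)
  next
    case (Suc n)
    have "u (Suc (Suc n)) t - u (Suc n) t
        = integral {0..t} (\<lambda>s. f (u (Suc n) s) - f (u n s))"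
    proof (subst Henstock_Kurzweil_Integration.integral_diff)
      show "u (Suc (Suc n)) t - u (Suc n) t
          = integral {0..t} (\<lambda>s. f (u (Suc n) s)) - integral {0..t} (\<lambda>s. f (u n s))"
        unfolding uS[of "Suc n" t] uS[of n t] by simp
    qed (intro integrable_continuous_interval fc ucont)+
    also have "norm \<dots> \<le> integral {0..t} (\<lambda>s. L * (M * L ^ n * s ^ Suc n / fact (Suc n)))"
    proof (rule integral_norm_bound_integral)
      show "(\<lambda>s. f (u (Suc n) s) - f (u n s)) integrable_on {0..t}"
        by (intro integrable_continuous_interval continuous_intros fc ucont)
      show "(\<lambda>s. L * (M * L ^ n * s ^ Suc n / fact (Suc n))) integrable_on {0..t}"
        by (intro integrable_continuous_interval continuous_intros) auto
      fix s assume "s \<in> {0..t}"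
      then have "norm (u (Suc n) s - u n s) \<le> M * L ^ n * s ^ Suc n / fact (Suc n)"
        using Suc.IH by auto
      then show "norm (f (u (Suc n) s) - f (u n s)) \<le> L * (M * L ^ n * s ^ Suc n / fact (Suc n))"
        using lip[of "u (Suc n) s" "u n s"] L by (meson mult_left_mono order_trans)
    qed
    also have "\<dots> = M * L ^ Suc n * t ^ Suc (Suc n) / fact (Suc (Suc n))"
    proof -
      have "((\<lambda>s. L * (M * L ^ n * s ^ Suc n / fact (Suc n))) has_integral
         (M * L ^ Suc n * t ^ Suc (Suc n) / fact (Suc (Suc n))
           - M * L ^ Suc n * 0 ^ Suc (Suc n) / fact (Suc (Suc n)))) {0..t}"
      proof (rule fundamental_theorem_of_calculus[OF Suc.prems])
        fix s assume "s \<in> {0..t}"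
        have *: "M * L ^ Suc n * (real (Suc (Suc n)) * s ^ Suc n) / fact (Suc (Suc n))
            = L * (M * L ^ n * s ^ Suc n / fact (Suc n))"
          by (simp add: fact_Suc[of "Suc n"] field_simps del: fact_Suc of_nat_Suc)
        have "((\<lambda>t. M * L ^ Suc n * t ^ Suc (Suc n) / fact (Suc (Suc n))) has_real_derivative
            M * L ^ Suc n * (real (Suc (Suc n)) * s ^ Suc n) / fact (Suc (Suc n))) (at s within {0..t})"
          by (rule derivative_eq_intros refl | simp)+
        then show "((\<lambda>t. M * L ^ Suc n * t ^ Suc (Suc n) / fact (Suc (Suc n))) has_vector_derivative
            L * (M * L ^ n * s ^ Suc n / fact (Suc n))) (at s within {0..t})"
          unfolding * has_real_derivative_iff_has_vector_derivative .
      qed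
      then have "integral {0..t} (\<lambda>s. L * (M * L ^ n * s ^ Suc n / fact (Suc n)))
        = M * L ^ Suc n * t ^ Suc (Suc n) / fact (Suc (Suc n))
           - M * L ^ Suc n * 0 ^ Suc (Suc n) / fact (Suc (Suc n))"
        by (rule integral_unique)
      then show ?thesis by simp
    qed
    finally show ?case .
  qed
  define U where "U t = x0 + (\<Sum>n. u (Suc n) t - u n t)" for t
  have unif: "uniform_limit {0..T} u U sequentially" for T
  proof -
    have "summable (\<lambda>n. M * T * ((L * T) ^ n / fact n))"
      using summable_exp[of "L * T"] by (intro summable_mult) (simp add: field_simps)
    then have "uniform_limit {0..T} (\<lambda>n t. \<Sum>i<n. u (Suc i) t - u i t)
        (\<lambda>t. \<Sum>i. u (Suc i) t - u i t) sequentially"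
    proof (rule Weierstrass_m_test[rotated])
      fix n t assume t: "t \<in> {0..T}"
      have "norm (u (Suc n) t - u n t) \<le> M * L ^ n * t ^ Suc n / fact (Suc n)"
        using bound t by auto
      also have "\<dots> \<le> M * L ^ n * T ^ Suc n / fact n"
        using t L by (intro frac_le mult_left_mono power_mono mult_nonneg_nonneg zero_le_power)
          (auto simp: M_def fact_mono simp del: fact_Suc)
      finally show "norm (u (Suc n) t - u n t) \<le> M * T * ((L * T) ^ n / fact n)"
        by (simp add: power_mult_distrib mult_ac)
    qed
    then have "uniform_limit {0..T} (\<lambda>n t. x0 + (\<Sum>i<n. u (Suc i) t - u i t)) U sequentially"
      unfolding U_def by (intro uniform_limit_intros)
    moreover have "(\<Sum>i<n. u (Suc i) t - u i t) = u n t - x0" for n t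
      using sum_lessThan_telescope[of "\<lambda>n. u n t" n] by (simp add: u0)
    ultimately show ?thesis by simp
  qed
  have Ucont: "continuous_on {0..T} U" for T
    by (rule uniform_limit_theorem[OF _ unif]) (auto simp: ucont)
  have Ueq: "U t = x0 + integral {0..t} (\<lambda>s. f (U s))" if "0 \<le> t" for t
  proof -
    have lim: "uniform_limit {0..t} (\<lambda>n s. f (u n s)) (\<lambda>s. f (U s)) sequentially"
    proof (rule uniform_limitI)
      fix e :: real assume "0 < e"
      then have "\<forall>\<^sub>F n in sequentially. \<forall>s\<in>{0..t}. dist (u n s) (U s) < e / (L + 1)"
        using L by (intro uniform_limitD[OF unif]) auto
      then show "\<forall>\<^sub>F n in sequentially. \<forall>s\<in>{0..t}. dist (f (u n s)) (f (U s)) < e"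
      proof eventually_elim
        case (elim n)
        show ?case
        proof
          fix s assume "s \<in> {0..t}"
          then have "(L + 1) * norm (u n s - U s) < e"
            using elim L by (simp add: dist_norm field_simps)
          moreover have "norm (f (u n s) - f (U s)) \<le> (L + 1) * norm (u n s - U s)"
            using lip[of "u n s" "U s"] by (simp add: algebra_simps add_increasing)
          ultimately show "dist (f (u n s)) (f (U s)) < e" by (simp add: dist_norm)
        qed
      qed
    qed
    obtain I J where IJ: "\<And>n. ((\<lambda>s. f (u n s)) has_integral I n) {0..t}"
        "((\<lambda>s. f (U s)) has_integral J) {0..t}" "I \<longlonglongrightarrow> J"
      using uniform_limit_integral[OF lim fc[OF ucont] trivial_limit_sequentially] by metis
    have "(\<lambda>n. integral {0..t} (\<lambda>s. f (u n s))) \<longlonglongrightarrow> integral {0..t} (\<lambda>s. f (U s))"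
      unfolding integral_unique[OF IJ(1)] integral_unique[OF IJ(2)] by (rule IJ(3))
    then have "(\<lambda>n. u (Suc n) t) \<longlonglongrightarrow> x0 + integral {0..t} (\<lambda>s. f (U s))"
      unfolding uS by (intro tendsto_intros)
    moreover have "(\<lambda>n. u (Suc n) t) \<longlonglongrightarrow> U t"
      using tendsto_uniform_limitI[OF unif[of t]] that by (intro LIMSEQ_Suc) auto
    ultimately show ?thesis using LIMSEQ_unique by blast
  qed
  have "(U has_vector_derivative f (U t)) (at t within {0..})" if t: "0 \<le> t" for t
  proof -
    have "(U has_vector_derivative f (U t)) (at t within {0..t+1})"
    proof (rule has_vector_derivative_transform)
      show "((\<lambda>t. x0 + integral {0..t} (\<lambda>s. f (U s))) has_vector_derivative f (U t))
          (at t within {0..t+1})" using t by (intro int_deriv Ucont) auto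
    qed (use t Ueq in auto)
    moreover have "at t within {0..t+1} = at t within {0..}"
      by (rule at_within_nhd[of _ "{..<t+1}"]) (use t in auto)
    ultimately show ?thesis by simp
  qed
  moreover have "U 0 = x0" using Ueq[of 0] by simp
  ultimately show ?thesis by blast
qed

section \<open>Barriers and uniqueness for coupled families\<close>

text \<open>A Gronwall lemma for an arbitrary family of real functions, without any regularity in the index: by
induction on \<open>n\<close>, every \<open>p i t\<close> is at least \<open>k - M * (C * t) ^ n / fact n\<close>. The rate
of \<open>p i\<close> is needed only while \<open>p i\<close> is below the barrier \<open>k\<close>, and it may depend on the whole family.\<close>

lemma family_barrier:
  fixes p p' :: "'i \<Rightarrow> real \<Rightarrow> real"
  assumes C: "0 \<le> C" and M: "0 \<le> M"
    and init: "\<And>i. i \<in> I \<Longrightarrow> p i 0 \<ge> k"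
    and low: "\<And>i t. i \<in> I \<Longrightarrow> 0 \<le> t \<Longrightarrow> k - M \<le> p i t"
    and deriv: "\<And>i t. i \<in> I \<Longrightarrow> 0 \<le> t \<Longrightarrow> (p i has_real_derivative p' i t) (at t within {0..})"
    and rate: "\<And>i t B. i \<in> I \<Longrightarrow> 0 \<le> t \<Longrightarrow> 0 \<le> B \<Longrightarrow> p i t \<le> k
      \<Longrightarrow> (\<And>j. j \<in> I \<Longrightarrow> k - B \<le> p j t) \<Longrightarrow> - (C * B) \<le> p' i t"
    and i: "i \<in> I" and t: "0 \<le> t"
  shows "k \<le> p i t"
proof -
  have bound: "k - M * C ^ n * t ^ n / fact n \<le> p i t" if "i \<in> I" "0 \<le> t" for n i t
    using that
  proof (induction n arbitrary: i t)
    case 0 then show ?case using low by simp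
  next
    case (Suc n)
    let ?b = "\<lambda>s. M * C ^ Suc n * s ^ Suc n / fact (Suc n)"
    have bpos: "0 \<le> ?b s" if "0 \<le> s" for s using that C M by auto
    show ?case
    proof (rule ccontr)
      assume neg: "\<not> ?case"
      then have lt: "p i t + ?b t < k" by simp
      have pc: "continuous_on {0..t} (p i)"
      proof (rule DERIV_continuous_on)
        fix x assume "x \<in> {0..t}"
        then show "(p i has_real_derivative p' i x) (at x within {0..t})"
          using deriv[OF Suc.prems(1), of x] by (auto elim: has_field_derivative_subset)
      qed
      \<comment> \<open>The last time \<open>s\<close> before \<open>t\<close> at which \<open>p i\<close> is not below the barrier.\<close>
      define S where "S = {0..t} \<inter> p i -` {k..}"
      have "closed S" unfolding S_def
        by (intro continuous_closed_preimage pc) auto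
      then have "compact S" using compact_Int_closed[of "{0..t}" S] by (simp add: S_def Int_absorb1)
      moreover have "0 \<in> S" using Suc.prems(2) init[OF Suc.prems(1)] by (simp add: S_def)
      ultimately obtain s where s: "s \<in> S" and smax: "\<And>x. x \<in> S \<Longrightarrow> x \<le> s"
        using compact_attains_sup[of S] by (metis empty_iff)
      have st: "0 \<le> s" "s \<le> t" "k \<le> p i s" using s by (auto simp: S_def)
      have below: "p i x < k" if "s < x" "x \<le> t" for x
        using smax[of x] that st by (force simp: S_def)
      have "p i s + ?b s \<le> p i t + ?b t"
      proof (rule DERIV_nonneg_imp_increasing_open[OF st(2), where f="\<lambda>s. p i s + ?b s"])
        show "continuous_on {s..t} (\<lambda>s. p i s + ?b s)"
          using continuous_on_subset[OF pc, of "{s..t}"] st by (intro continuous_intros) auto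
        fix x assume x: "s < x" "x < t"
        have x0: "0 < x" using x st by simp
        have "(p i has_real_derivative p' i x) (at x)"
          using deriv[OF Suc.prems(1), of x] x0
          by (metis at_within_interior interior_real_atLeast greaterThan_iff less_imp_le)
        moreover have "(?b has_real_derivative C * (M * C ^ n * x ^ n / fact n)) (at x)"
        proof -
          have *: "M * C ^ Suc n * (real (Suc n) * x ^ n) / fact (Suc n)
            = C * (M * C ^ n * x ^ n / fact n)"
            by (simp add: fact_Suc[of "n"] field_simps del: of_nat_Suc)
          have "(?b has_real_derivative M * C ^ Suc n * (real (Suc n) * x ^ n) / fact (Suc n)) (at x)"
            by (rule derivative_eq_intros refl | simp)+
          then show ?thesis unfolding * .
        qed
        ultimately have "((\<lambda>s. p i s + ?b s) has_real_derivative
            p' i x + C * (M * C ^ n * x ^ n / fact n)) (at x)" by (rule DERIV_add)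
        moreover have "- (C * (M * C ^ n * x ^ n / fact n)) \<le> p' i x"
          using Suc.IH x0 C M below[of x] x by (intro rate[OF Suc.prems(1)]) auto
        ultimately show "\<exists>y. ((\<lambda>s. p i s + ?b s) has_real_derivative y) (at x) \<and> 0 \<le> y"
          by force
      qed
      then show False using lt st bpos[of s] by simp
    qed
  qed
  have "(\<lambda>n. k - M * ((C * t) ^ n / fact n)) \<longlonglongrightarrow> k - M * 0"
    using summable_LIMSEQ_zero[OF summable_exp[of "C * t"]]
    by (intro tendsto_intros) (simp add: field_simps)
  then show ?thesis
    using bound[OF i t] by (intro LIMSEQ_le_const2[where X="\<lambda>n. k - M * ((C * t) ^ n / fact n)" and x=k])
      (auto simp: power_mult_distrib mult_ac)
qed

lemma family_ode_unique:
  fixes X Y :: "'i \<Rightarrow> real \<Rightarrow> 'a::real_inner"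
  assumes C: "0 \<le> C"
    and init: "\<And>i. i \<in> I \<Longrightarrow> X i 0 = Y i 0"
    and bd: "\<And>i t. i \<in> I \<Longrightarrow> 0 \<le> t \<Longrightarrow> norm (X i t - Y i t) \<le> M"
    and X: "\<And>i t. i \<in> I \<Longrightarrow> 0 \<le> t \<Longrightarrow> (X i has_vector_derivative X' i t) (at t within {0..})"
    and Y: "\<And>i t. i \<in> I \<Longrightarrow> 0 \<le> t \<Longrightarrow> (Y i has_vector_derivative Y' i t) (at t within {0..})"
    and rate: "\<And>i t B. i \<in> I \<Longrightarrow> 0 \<le> t \<Longrightarrow> 0 \<le> B \<Longrightarrow>
      (\<And>j. j \<in> I \<Longrightarrow> norm (X j t - Y j t) \<le> B) \<Longrightarrow> norm (X' i t - Y' i t) \<le> C * B"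
    and i: "i \<in> I" and t: "0 \<le> t"
  shows "X i t = Y i t"
proof -
  have "0 \<le> - (norm (X i t - Y i t))\<^sup>2"
  proof (rule family_barrier[where C="2 * C" and M="M\<^sup>2" and I=I and p="\<lambda>i t. - (norm (X i t - Y i t))\<^sup>2"
        and p'="\<lambda>i t. - (2 * ((X i t - Y i t) \<bullet> (X' i t - Y' i t)))"])
    fix i and t :: real assume it: "i \<in> I" "0 \<le> t"
    show "0 - M\<^sup>2 \<le> - (norm (X i t - Y i t))\<^sup>2" using bd[OF it] by (simp add: power_mono)
    have "((\<lambda>t. X i t - Y i t) has_derivative (\<lambda>h. h *\<^sub>R (X' i t - Y' i t))) (at t within {0..})"
      using has_vector_derivative_diff[OF X[OF it] Y[OF it]] by (simp add: has_vector_derivative_def)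
    from has_derivative_inner[OF this this]
    have "((\<lambda>t. (norm (X i t - Y i t))\<^sup>2) has_derivative
        (\<lambda>h. h * (2 * ((X i t - Y i t) \<bullet> (X' i t - Y' i t))))) (at t within {0..})"
      by (simp add: power2_norm_eq_inner inner_commute algebra_simps)
    then have "((\<lambda>t. (norm (X i t - Y i t))\<^sup>2) has_real_derivative
        2 * ((X i t - Y i t) \<bullet> (X' i t - Y' i t))) (at t within {0..})"
      by (simp add: has_field_derivative_def mult_commute_abs)
    then show "((\<lambda>t. - (norm (X i t - Y i t))\<^sup>2) has_real_derivative
        - (2 * ((X i t - Y i t) \<bullet> (X' i t - Y' i t)))) (at t within {0..})"
      by (rule DERIV_minus)
    fix B :: real assume B: "0 \<le> B" "\<And>j. j \<in> I \<Longrightarrow> 0 - B \<le> - (norm (X j t - Y j t))\<^sup>2"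
    have le: "norm (X j t - Y j t) \<le> sqrt B" if "j \<in> I" for j
      using B(2)[OF that] by (intro real_le_rsqrt) simp
    have "(X i t - Y i t) \<bullet> (X' i t - Y' i t) \<le> norm (X i t - Y i t) * norm (X' i t - Y' i t)"
      by (rule norm_cauchy_schwarz)
    also have "\<dots> \<le> sqrt B * (C * sqrt B)"
      using B(1) by (intro mult_mono le rate it) auto
    also have "\<dots> = C * B" using B(1) by simp
    finally show "- (2 * C * B) \<le> - (2 * ((X i t - Y i t) \<bullet> (X' i t - Y' i t)))" by simp
  qed (use C init i t in auto)
  then show ?thesis by simp
qed

section \<open>Flows driven by an average over the moving particles\<close>

lemma (in prob_space) norm_integral_diff_le:
  fixes f h :: "'a \<Rightarrow> 'b::{banach, second_countable_topology}"
  assumes "integrable M f" "integrable M h" and le: "\<And>y. y \<in> space M \<Longrightarrow> norm (f y - h y) \<le> e"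
  shows "norm ((LINT y|M. f y) - (LINT y|M. h y)) \<le> e"
proof -
  have "norm ((LINT y|M. f y) - (LINT y|M. h y)) = norm (LINT y|M. f y - h y)"
    using assms by (simp add: Bochner_Integration.integral_diff)
  also have "\<dots> \<le> (LINT y|M. e)"
    using assms by (intro order_trans[OF integral_norm_bound] integral_mono integrable_norm
        Bochner_Integration.integrable_diff) auto
  finally show ?thesis by (simp add: prob_space)
qed

instance bcontfun :: (metric_space, banach) banach ..

text \<open>The points \<open>x\<close> need not lie in the same space as the values of the flow, and the equation holds for
every \<open>x\<close>, not only on the support of \<open>\<mu>\<close>.\<close>

lemma mean_field_flow_exists:
  fixes F :: "'a::euclidean_space \<Rightarrow> 'a \<Rightarrow> 'a" and \<mu> :: "'b::metric_space measure"
  assumes \<mu>: "prob_space \<mu>"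
    and meas: "\<And>f :: 'b \<Rightarrow> 'a. continuous_on UNIV f \<Longrightarrow> f \<in> borel_measurable \<mu>"
    and bound: "\<And>a b. norm (F a b) \<le> M"
    and lip: "\<And>a b a' b'. norm (F a b - F a' b') \<le> L * (norm (a - a') + norm (b - b'))" and L: "0 \<le> L"
    and x0: "continuous_on UNIV x0" "bounded (range x0)"
  obtains \<Psi> :: "real \<Rightarrow> 'b \<Rightarrow> 'a" where "\<Psi> 0 = x0" "\<And>t. continuous_on UNIV (\<Psi> t)"
    "\<And>t x. 0 \<le> t \<Longrightarrow> ((\<lambda>s. \<Psi> s x) has_vector_derivative (LINT y|\<mu>. F (\<Psi> t x) (\<Psi> t y)))
       (at t within {0..})"
proof -
  interpret prob_space \<mu> by fact
  have Fcont: "continuous_on UNIV (F a)" for a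
  proof -
    have "L-lipschitz_on UNIV (F a)"
      using lip[of a _ a] L by (auto intro!: lipschitz_onI simp: dist_norm)
    then show ?thesis by (rule lipschitz_on_continuous_on)
  qed
  have int: "integrable \<mu> (\<lambda>y. F a (u y))" if "continuous_on UNIV u" for a u
    using bound
    by (intro integrable_const_bound[where B=M] meas continuous_on_compose2[OF Fcont that]) auto
  have int_lip: "norm ((LINT y|\<mu>. F a (u y)) - (LINT y|\<mu>. F b (v y))) \<le> L * (norm (a - b) + e)"
    if uv: "continuous_on UNIV u" "continuous_on UNIV v" and e: "\<And>y. norm (u y - v y) \<le> e" for a b u v e
  proof (rule norm_integral_diff_le[OF int[OF uv(1)] int[OF uv(2)]])
    fix y
    show "norm (F a (u y) - F b (v y)) \<le> L * (norm (a - b) + e)"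
      using lip[of a "u y" b "v y"] e[of y] L by (meson add_left_mono mult_left_mono order_trans)
  qed
  \<comment> \<open>The system as one differential equation \<open>u' = V u\<close> for the function \<open>u = \<Psi> t\<close>.\<close>
  define V :: "('b \<Rightarrow>\<^sub>C 'a) \<Rightarrow> ('b \<Rightarrow>\<^sub>C 'a)" where "V u = Bcontfun (\<lambda>x. LINT y|\<mu>. F (u x) (u y))" for u
  have ucont: "continuous_on UNIV (apply_bcontfun u)" for u :: "'b \<Rightarrow>\<^sub>C 'a"
    using apply_bcontfun by (simp add: bcontfun_def)
  have apply_V: "apply_bcontfun (V u) x = (LINT y|\<mu>. F (u x) (u y))" for u x
  proof -
    have "(\<lambda>x. LINT y|\<mu>. F (u x) (u y)) \<in> bcontfun"
    proof (rule bcontfun_normI[where b=M])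
      have "L-lipschitz_on UNIV (\<lambda>a. LINT y|\<mu>. F a (u y))"
        using int_lip[OF ucont ucont, of u u 0] L by (auto intro!: lipschitz_onI simp: dist_norm)
      then show "continuous_on UNIV (\<lambda>x. LINT y|\<mu>. F (u x) (u y))"
        by (intro continuous_on_compose2[OF lipschitz_on_continuous_on ucont]) auto
      fix x
      have "norm (LINT y|\<mu>. F (u x) (u y)) \<le> (LINT y|\<mu>. M)"
        by (rule order_trans[OF integral_norm_bound], rule integral_mono)
          (auto intro!: integrable_norm int ucont bound)
      then show "norm (LINT y|\<mu>. F (u x) (u y)) \<le> M" by (simp add: prob_space)
    qed
    then show ?thesis by (simp add: V_def Bcontfun_inverse)
  qed
  have Vlip: "norm (V u - V v) \<le> 2 * L * norm (u - v)" for u v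
  proof (rule norm_bound)
    fix x
    have nb: "norm (u y - v y) \<le> norm (u - v)" for y
      using norm_bounded[of "u - v" y] by simp
    have "norm ((V u - V v) x) \<le> L * (norm (u x - v x) + norm (u - v))"
      using int_lip[OF ucont ucont nb] by (simp add: apply_V)
    also have "\<dots> \<le> L * (norm (u - v) + norm (u - v))" using nb L by (intro mult_left_mono add_mono) auto
    finally show "norm ((V u - V v) x) \<le> 2 * L * norm (u - v)" by simp
  qed
  obtain u where u: "u 0 = Bcontfun x0"
    "\<And>t. 0 \<le> t \<Longrightarrow> (u has_vector_derivative V (u t)) (at t within {0..})"
    using lipschitz_ode_exists[of V "2 * L" "Bcontfun x0"] Vlip L by auto
  show thesis
  proof (rule that[of "\<lambda>t. apply_bcontfun (u t)"])
    have "x0 \<in> bcontfun" using x0 by (simp add: bcontfun_def)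
    then show "apply_bcontfun (u 0) = x0" by (simp add: u Bcontfun_inverse)
    show "continuous_on UNIV (apply_bcontfun (u t))" for t by (rule ucont)
    fix t :: real and x assume t: "0 \<le> t"
    have "bounded_linear (\<lambda>w :: 'b \<Rightarrow>\<^sub>C 'a. apply_bcontfun w x)"
      by (rule bounded_linear_intro[where K=1]) (auto simp: norm_bounded)
    from bounded_linear.has_vector_derivative[OF this u(2)[OF t]]
    show "((\<lambda>s. (u s) x) has_vector_derivative (LINT y|\<mu>. F ((u t) x) ((u t) y))) (at t within {0..})"
      by (simp add: apply_V)
  qed
qed

section \<open>Rotation matrices and their Rodrigues parameters\<close>

lemmas mat3 = matrix_matrix_mult_def matrix_vector_mult_def transpose_def vec_eq_iff forall_3 sum_3
   trace_def mat_def inner_vec_def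

lemma trace_transpose_mult: "trace (transpose A ** B) = A \<bullet> (B :: real^'n^'n)"
  unfolding trace_def transpose_def matrix_matrix_mult_def inner_vec_def
  by (simp, rule sum.swap)

lemma geodist_eq: "geodist R Q = arccos ((R \<bullet> Q - 1) / 2)"
  by (simp add: geodist_def trace_transpose_mult)

lemma SO3_iff: "R \<in> SO3 \<longleftrightarrow> transpose R ** R = mat 1 \<and> det R = 1"
  by (simp add: SO3_def rotation_matrix_def orthogonal_matrix)

text \<open>The rotation with Rodrigues (Gibbs) vector \<open>(a, b, c)\<close>, which is the axis scaled by the tangent of half of the
angle: it belongs to the unit quaternion proportional to \<open>(1, a, b, c)\<close>. All rotations except those by the
angle \<open>pi\<close>, that is those with trace \<open>- 1\<close>, are obtained in this rational way.\<close>

definition rodrigues :: "real \<Rightarrow> real \<Rightarrow> real \<Rightarrow> real^3^3" where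
  "rodrigues a b c = (1 / (1 + a\<^sup>2 + b\<^sup>2 + c\<^sup>2)) *\<^sub>R vector
     [vector [1 + a\<^sup>2 - b\<^sup>2 - c\<^sup>2, 2 * (a * b - c), 2 * (a * c + b)],
      vector [2 * (a * b + c), 1 - a\<^sup>2 + b\<^sup>2 - c\<^sup>2, 2 * (b * c - a)],
      vector [2 * (a * c - b), 2 * (b * c + a), 1 - a\<^sup>2 - b\<^sup>2 + c\<^sup>2]]"

lemma rodrigues_denom_pos: "0 < 1 + a\<^sup>2 + b\<^sup>2 + (c::real)\<^sup>2"
  by (smt (verit) zero_le_power2)

lemma rodrigues_scale:
  obtains n where "n * (1 + a\<^sup>2 + b\<^sup>2 + (c::real)\<^sup>2) = 1"
  using rodrigues_denom_pos[of a b c] by (intro that[of "1 / (1 + a\<^sup>2 + b\<^sup>2 + c\<^sup>2)"]) simp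

lemma rodrigues_scale_eq:
  "n * (1 + a\<^sup>2 + b\<^sup>2 + (c::real)\<^sup>2) = 1 \<Longrightarrow> 1 / (1 + a\<^sup>2 + b\<^sup>2 + c\<^sup>2) = n"
  using rodrigues_denom_pos[of a b c] by (simp add: field_simps)

lemma rodrigues_nth:
  assumes n: "n * (1 + a\<^sup>2 + b\<^sup>2 + c\<^sup>2) = 1"
  shows "rodrigues a b c $ 1 $ 1 = n * (1 + a\<^sup>2 - b\<^sup>2 - c\<^sup>2)"
    "rodrigues a b c $ 1 $ 2 = n * (2 * (a * b - c))"
    "rodrigues a b c $ 1 $ 3 = n * (2 * (a * c + b))"
    "rodrigues a b c $ 2 $ 1 = n * (2 * (a * b + c))"
    "rodrigues a b c $ 2 $ 2 = n * (1 - a\<^sup>2 + b\<^sup>2 - c\<^sup>2)"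
    "rodrigues a b c $ 2 $ 3 = n * (2 * (b * c - a))"
    "rodrigues a b c $ 3 $ 1 = n * (2 * (a * c - b))"
    "rodrigues a b c $ 3 $ 2 = n * (2 * (b * c + a))"
    "rodrigues a b c $ 3 $ 3 = n * (1 - a\<^sup>2 - b\<^sup>2 + c\<^sup>2)"
  unfolding rodrigues_def rodrigues_scale_eq[OF n] by (simp_all add: vector_3)

lemma rodrigues_SO3: "rodrigues a b c \<in> SO3"
proof -
  obtain n where n: "n * (1 + a\<^sup>2 + b\<^sup>2 + c\<^sup>2) = 1"
    by (rule rodrigues_scale)
  note e = rodrigues_nth[OF n]
  have
    "rodrigues a b c $1$1 * rodrigues a b c $1$1 + rodrigues a b c $2$1 * rodrigues a b c $2$1 + rodrigues a b c $3$1 * rodrigues a b c $3$1 = 1"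
    "rodrigues a b c $1$2 * rodrigues a b c $1$2 + rodrigues a b c $2$2 * rodrigues a b c $2$2 + rodrigues a b c $3$2 * rodrigues a b c $3$2 = 1"
    "rodrigues a b c $1$3 * rodrigues a b c $1$3 + rodrigues a b c $2$3 * rodrigues a b c $2$3 + rodrigues a b c $3$3 * rodrigues a b c $3$3 = 1"
    "rodrigues a b c $1$1 * rodrigues a b c $1$2 + rodrigues a b c $2$1 * rodrigues a b c $2$2 + rodrigues a b c $3$1 * rodrigues a b c $3$2 = 0"
    "rodrigues a b c $1$1 * rodrigues a b c $1$3 + rodrigues a b c $2$1 * rodrigues a b c $2$3 + rodrigues a b c $3$1 * rodrigues a b c $3$3 = 0"
    "rodrigues a b c $1$2 * rodrigues a b c $1$3 + rodrigues a b c $2$2 * rodrigues a b c $2$3 + rodrigues a b c $3$2 * rodrigues a b c $3$3 = 0"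
    unfolding e using n by (algebra | simp add: algebra_simps power2_eq_square)+
  then have "transpose (rodrigues a b c) ** rodrigues a b c = mat 1"
    by (simp add: mat3 mult.commute)
  moreover have "det (rodrigues a b c) = 1"
    unfolding det_3 e using n by algebra
  ultimately show ?thesis by (simp add: SO3_iff)
qed

lemma trace_rodrigues: "trace (rodrigues a b c) = 4 / (1 + a\<^sup>2 + b\<^sup>2 + c\<^sup>2) - 1"
proof -
  obtain n where n: "n * (1 + a\<^sup>2 + b\<^sup>2 + c\<^sup>2) = 1"
    by (rule rodrigues_scale)
  note e = rodrigues_nth[OF n]
  have "trace (rodrigues a b c) = 4 * n - 1"
    unfolding trace_def sum_3 e using n by algebra
  moreover have "n = 1 / (1 + a\<^sup>2 + b\<^sup>2 + c\<^sup>2)" by (rule rodrigues_scale_eq[OF n, symmetric])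
  ultimately show ?thesis by simp
qed

text \<open>A rotation matrix is its own cofactor matrix: each column is the cross product of the two others.\<close>

lemma SO3_cofactor:
  assumes "R \<in> SO3"
  shows "R$1$1 = R$2$2 * R$3$3 - R$2$3 * R$3$2"
    "R$2$2 = R$1$1 * R$3$3 - R$1$3 * R$3$1"
    "R$3$3 = R$1$1 * R$2$2 - R$1$2 * R$2$1"
    "R$1$2 = R$2$3 * R$3$1 - R$2$1 * R$3$3"
    "R$2$1 = R$1$3 * R$3$2 - R$1$2 * R$3$3"
    "R$1$3 = R$2$1 * R$3$2 - R$2$2 * R$3$1"
    "R$3$1 = R$1$2 * R$2$3 - R$1$3 * R$2$2"
    "R$2$3 = R$3$1 * R$1$2 - R$1$1 * R$3$2"
    "R$3$2 = R$2$1 * R$1$3 - R$1$1 * R$2$3"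
proof -
  have col: "R *v axis j 1 = (\<chi> i. R $ i $ j)" for j
    by (simp add: matrix_vector_mult_basis column_def)
  have "cross3 (R *v axis j 1) (R *v axis k 1) = R *v cross3 (axis j 1) (axis k 1)" for j k
    using assms by (simp add: SO3_def cross_rotation_matrix)
  from this[of 2 3] this[of 3 1] this[of 1 2] show
    "R$1$1 = R$2$2 * R$3$3 - R$2$3 * R$3$2"
    "R$2$2 = R$1$1 * R$3$3 - R$1$3 * R$3$1"
    "R$3$3 = R$1$1 * R$2$2 - R$1$2 * R$2$1"
    "R$1$2 = R$2$3 * R$3$1 - R$2$1 * R$3$3"
    "R$2$1 = R$1$3 * R$3$2 - R$1$2 * R$3$3"
    "R$1$3 = R$2$1 * R$3$2 - R$2$2 * R$3$1"
    "R$3$1 = R$1$2 * R$2$3 - R$1$3 * R$2$2"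
    "R$2$3 = R$3$1 * R$1$2 - R$1$1 * R$3$2"
    "R$3$2 = R$2$1 * R$1$3 - R$1$1 * R$2$3"
    unfolding cross_basis
    by (simp_all add: col cross3_def vec_eq_iff forall_3 vector_3 algebra_simps)
qed

text \<open>In terms of the unit quaternion \<open>(q0, q)\<close> of \<open>R\<close>, the off-diagonal entries of \<open>R - transpose R\<close> are \<open>4 * q0 * q i\<close> up to sign,
and \<open>1 + trace R = 4 * q0\<^sup>2\<close>. These are the identities for the products of two such entries, stated without the quaternion.\<close>

lemma SO3_skew_part_products:
  fixes R :: "real^3^3"
  assumes "R \<in> SO3"
  shows "(R$3$2 - R$2$3)\<^sup>2 = (1 + trace R) * (1 + 2 * R$1$1 - trace R)"
    "(R$1$3 - R$3$1)\<^sup>2 = (1 + trace R) * (1 + 2 * R$2$2 - trace R)"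
    "(R$2$1 - R$1$2)\<^sup>2 = (1 + trace R) * (1 + 2 * R$3$3 - trace R)"
    "(R$3$2 - R$2$3) * (R$1$3 - R$3$1) = (1 + trace R) * (R$1$2 + R$2$1)"
    "(R$3$2 - R$2$3) * (R$2$1 - R$1$2) = (1 + trace R) * (R$1$3 + R$3$1)"
    "(R$1$3 - R$3$1) * (R$2$1 - R$1$2) = (1 + trace R) * (R$2$3 + R$3$2)"
proof -
  have "transpose R ** R = mat 1" "R ** transpose R = mat 1" using assms
    by (simp_all add: SO3_iff matrix_left_right_inverse)
  then have o:
     "R$1$1 * R$1$1 + R$2$1 * R$2$1 + R$3$1 * R$3$1 = 1"
     "R$1$2 * R$1$2 + R$2$2 * R$2$2 + R$3$2 * R$3$2 = 1"
     "R$1$3 * R$1$3 + R$2$3 * R$2$3 + R$3$3 * R$3$3 = 1"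
     "R$1$1 * R$1$1 + R$1$2 * R$1$2 + R$1$3 * R$1$3 = 1"
     "R$2$1 * R$2$1 + R$2$2 * R$2$2 + R$2$3 * R$2$3 = 1"
     "R$3$1 * R$3$1 + R$3$2 * R$3$2 + R$3$3 * R$3$3 = 1"
    by (simp_all add: mat3)
  have o2:
     "R$1$1 * R$1$2 + R$2$1 * R$2$2 + R$3$1 * R$3$2 = 0"
     "R$1$1 * R$1$3 + R$2$1 * R$2$3 + R$3$1 * R$3$3 = 0"
     "R$1$2 * R$1$3 + R$2$2 * R$2$3 + R$3$2 * R$3$3 = 0"
     "R$1$1 * R$2$1 + R$1$2 * R$2$2 + R$1$3 * R$2$3 = 0"
     "R$1$1 * R$3$1 + R$1$2 * R$3$2 + R$1$3 * R$3$3 = 0"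
     "R$2$1 * R$3$1 + R$2$2 * R$3$2 + R$2$3 * R$3$3 = 0"
    using \<open>transpose R ** R = mat 1\<close> \<open>R ** transpose R = mat 1\<close> by (simp_all add: mat3)
  note c = SO3_cofactor[OF assms]
  have t: "trace R = R$1$1 + R$2$2 + R$3$3" by (simp add: trace_def sum_3)
  show "(R$3$2 - R$2$3)\<^sup>2 = (1 + trace R) * (1 + 2 * R$1$1 - trace R)"
    "(R$1$3 - R$3$1)\<^sup>2 = (1 + trace R) * (1 + 2 * R$2$2 - trace R)"
    "(R$2$1 - R$1$2)\<^sup>2 = (1 + trace R) * (1 + 2 * R$3$3 - trace R)"
    unfolding t using o c(1,2,3)
    by (simp_all (no_asm_use) only: power2_eq_square algebra_simps, (linarith+)?)
  show
    "(R$3$2 - R$2$3) * (R$1$3 - R$3$1) = (1 + trace R) * (R$1$2 + R$2$1)"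
    "(R$3$2 - R$2$3) * (R$2$1 - R$1$2) = (1 + trace R) * (R$1$3 + R$3$1)"
    "(R$1$3 - R$3$1) * (R$2$1 - R$1$2) = (1 + trace R) * (R$2$3 + R$3$2)"
    unfolding t using c(4-9) o2
    by (simp_all (no_asm_use) only: algebra_simps, (linarith+)?)
qed

lemma SO3_trace_bounds:
  assumes "R \<in> SO3"
  shows "- 1 \<le> trace R" "trace R \<le> 3"
proof -
  note d = SO3_skew_part_products[OF assms]
  have "(R$3$2 - R$2$3)\<^sup>2 + (R$1$3 - R$3$1)\<^sup>2 + (R$2$1 - R$1$2)\<^sup>2
      = (1 + trace R) * (3 - trace R)"
    unfolding d by (simp add: trace_def sum_3 algebra_simps)
  then have "0 \<le> (1 + trace R) * (3 - trace R)"
    by (metis add_nonneg_nonneg zero_le_power2)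
  then show "- 1 \<le> trace R" "trace R \<le> 3"
    by (auto simp: zero_le_mult_iff)
qed

lemma SO3_eq_rodrigues:
  assumes R: "R \<in> SO3" and t: "- 1 < trace R"
  obtains a b c where "R = rodrigues a b c"
proof -
  define k where "k = 1 + trace R"
  have k: "k > 0" using t by (simp add: k_def)
  have tr: "R$1$1 + R$2$2 + R$3$3 = k - 1" by (simp add: k_def trace_def sum_3)
  define a b c where "a = (R$3$2 - R$2$3) / k" and "b = (R$1$3 - R$3$1) / k"
    and "c = (R$2$1 - R$1$2) / k"
  note abc = a_def b_def c_def
  have tk: "trace R = k - 1" by (simp add: k_def)
  note d = SO3_skew_part_products[OF R, folded k_def, unfolded tk]
  have sq: "k * a\<^sup>2 = 2 + 2 * R$1$1 - k" "k * b\<^sup>2 = 2 + 2 * R$2$2 - k"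
     "k * c\<^sup>2 = 2 + 2 * R$3$3 - k"
    unfolding abc power_divide d using k by (simp_all add: power2_eq_square)
  have pr: "k * (a * b) = R$1$2 + R$2$1" "k * (a * c) = R$1$3 + R$3$1" "k * (b * c) = R$2$3 + R$3$2"
    unfolding abc times_divide_times_eq d using k by simp_all
  have li: "k * a = R$3$2 - R$2$3" "k * b = R$1$3 - R$3$1" "k * c = R$2$1 - R$1$2"
    using k by (simp_all add: abc)
  obtain n where n: "n * (1 + a\<^sup>2 + b\<^sup>2 + c\<^sup>2) = 1"
    by (rule rodrigues_scale)
  note e = rodrigues_nth[OF n]
  \<comment> \<open>The scalar factor of the Rodrigues matrix is \<open>k / 4\<close>, and with it each entry is linear in the products above.\<close>
  have "k * (1 + a\<^sup>2 + b\<^sup>2 + c\<^sup>2) = 4"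
    using sq tr by (simp add: distrib_left)
  then have "n * 4 = k * (n * (1 + a\<^sup>2 + b\<^sup>2 + c\<^sup>2))" by (metis mult.left_commute)
  then have nk: "n = k / 4" using n by simp
  have h: "k / 4 * (2 * (p - q)) = (k * p - k * q) / 2" "k / 4 * (2 * (p + q)) = (k * p + k * q) / 2"
     "k / 4 * (1 + p - q - s) = (k + k * p - k * q - k * s) / 4"
     "k / 4 * (1 - p + q - s) = (k - k * p + k * q - k * s) / 4"
     "k / 4 * (1 - p - q + s) = (k - k * p - k * q + k * s) / 4" for p q s
    by (simp_all add: field_simps)
  have "R = rodrigues a b c"
    unfolding vec_eq_iff forall_3 e nk h sq pr li by (intro conjI; use tr in \<open>simp add: field_simps\<close>)
  then show thesis by (rule that)
qed

lemma SO3_mult: "A \<in> SO3 \<Longrightarrow> B \<in> SO3 \<Longrightarrow> A ** B \<in> SO3"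
  by (simp add: SO3_def rotation_matrix_def orthogonal_matrix_mul det_mul)

lemma SO3_transpose: "A \<in> SO3 \<Longrightarrow> transpose A \<in> SO3"
  by (simp add: SO3_def rotation_matrix_def orthogonal_matrix_transpose)

lemma SO3_inner_bounds:
  assumes "A \<in> SO3" "B \<in> SO3"
  shows "- 1 \<le> A \<bullet> B" "A \<bullet> B \<le> 3"
  using SO3_trace_bounds[OF SO3_mult[OF SO3_transpose[OF assms(1)] assms(2)]]
  by (simp_all add: trace_transpose_mult)

lemma SO3_inner_self: "A \<in> SO3 \<Longrightarrow> A \<bullet> A = 3"
  by (simp add: trace_transpose_mult[symmetric] SO3_iff) (simp add: trace_def mat_def sum_3)

lemma SO3_norm: "A \<in> SO3 \<Longrightarrow> norm A = sqrt 3"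
  by (simp add: norm_eq_sqrt_inner SO3_inner_self)

lemma inner_rodrigues:
  "rodrigues a b c \<bullet> rodrigues x y z = 4 * (1 + (a * x + b * y + c * z))\<^sup>2
     / ((1 + a\<^sup>2 + b\<^sup>2 + c\<^sup>2) * (1 + x\<^sup>2 + y\<^sup>2 + z\<^sup>2)) - 1"
proof -
  have ne: "(1 + a\<^sup>2 + b\<^sup>2 + c\<^sup>2) * (1 + x\<^sup>2 + y\<^sup>2 + z\<^sup>2) \<noteq> 0"
    using rodrigues_denom_pos[of a b c] rodrigues_denom_pos[of x y z] by simp
  have "rodrigues a b c \<bullet> rodrigues x y z * ((1 + a\<^sup>2 + b\<^sup>2 + c\<^sup>2) * (1 + x\<^sup>2 + y\<^sup>2 + z\<^sup>2))
     = 4 * (1 + (a * x + b * y + c * z))\<^sup>2 - (1 + a\<^sup>2 + b\<^sup>2 + c\<^sup>2) * (1 + x\<^sup>2 + y\<^sup>2 + z\<^sup>2)"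
    using ne unfolding rodrigues_def inner_scaleR_left inner_scaleR_right
    by (simp add: inner_vec_def sum_3 vector_3) (simp add: algebra_simps power2_eq_square)
  then show ?thesis using ne by (simp add: eq_divide_eq diff_divide_distrib[symmetric] field_simps)
qed

text \<open>Since \<open>B - A ** transpose B ** A\<close> points from \<open>A\<close> towards \<open>B\<close>, its trace is the rate at which the trace
of \<open>A\<close> grows, and thus tells whether \<open>A\<close> is pulled towards the identity.\<close>

lemma trace_attraction_rodrigues:
  assumes A_def: "A = rodrigues a b c" and B_def: "B = rodrigues x y z"
  shows "trace (B - A ** transpose B ** A) = 16 * (1 + (a * x + b * y + c * z))
      * (a\<^sup>2 + b\<^sup>2 + c\<^sup>2 - (a * x + b * y + c * z))
     / ((1 + a\<^sup>2 + b\<^sup>2 + c\<^sup>2)\<^sup>2 * (1 + x\<^sup>2 + y\<^sup>2 + z\<^sup>2))"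
proof -
  obtain n where n: "n * (1 + a\<^sup>2 + b\<^sup>2 + c\<^sup>2) = 1"
    by (rule rodrigues_scale)
  note e = rodrigues_nth[OF n, folded A_def]
  obtain m where m: "m * (1 + x\<^sup>2 + y\<^sup>2 + z\<^sup>2) = 1"
    by (rule rodrigues_scale)
  note f = rodrigues_nth[OF m, folded B_def]
  have sq: "A $ i $ 1 * A $ 1 $ j + A $ i $ 2 * A $ 2 $ j + A $ i $ 3 * A $ 3 $ j
      = (A ** A) $ i $ j" for i j by (simp add: matrix_matrix_mult_def sum_3)
  have "trace (B - A ** transpose B ** A) = trace B - (A ** A) \<bullet> B"
  proof -
    have "trace (A ** transpose B ** A) = trace ((A ** A) ** transpose B)"
      by (metis matrix_mul_assoc trace_mul_sym)
    also have "\<dots> = B \<bullet> (A ** A)" by (metis trace_mul_sym trace_transpose_mult)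
    finally show ?thesis by (simp add: trace_def sum_subtractf inner_commute)
  qed
  also have "\<dots> = n\<^sup>2 * m * ((1 + a\<^sup>2 + b\<^sup>2 + c\<^sup>2)\<^sup>2 * (3 - x\<^sup>2 - y\<^sup>2 - z\<^sup>2)) - (A ** A) \<bullet> B"
  proof -
    have "trace B = m * (3 - x\<^sup>2 - y\<^sup>2 - z\<^sup>2)" by (simp add: trace_def sum_3 f algebra_simps)
    then show ?thesis using n by algebra
  qed
  also have "\<dots> = n\<^sup>2 * m * (16 * (1 + (a * x + b * y + c * z))
      * (a\<^sup>2 + b\<^sup>2 + c\<^sup>2 - (a * x + b * y + c * z)))"
    unfolding inner_vec_def sum_3 inner_real_def sq[symmetric] e f
    by (simp add: algebra_simps power2_eq_square)
  also have "n = 1 / (1 + a\<^sup>2 + b\<^sup>2 + c\<^sup>2)" by (rule rodrigues_scale_eq[OF n, symmetric])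
  also have "m = 1 / (1 + x\<^sup>2 + y\<^sup>2 + z\<^sup>2)" by (rule rodrigues_scale_eq[OF m, symmetric])
  finally show ?thesis by (simp add: power_divide)
qed

text \<open>With \<open>u, v\<close> the squared lengths and \<open>w\<close> the inner product of the two Rodrigues vectors, the trace is a positive
multiple of \<open>u - w\<close>, and \<open>u - w \<ge> (u - v) / 2\<close>, where \<open>u - v\<close> is a positive multiple of \<open>trace B - trace A\<close>.
The factor \<open>1 + w\<close> is positive because both angles are less than \<open>pi / 2\<close>.\<close>

lemma trace_attraction_lower_bound:
  assumes AB: "A \<in> SO3" "B \<in> SO3" and t: "1 < trace A" "1 < trace B"
  shows "- 4 * max 0 (trace A - trace B) \<le> trace (B - A ** transpose B ** A)"
proof -
  have tpos: "- 1 < trace A" "- 1 < trace B" using t by auto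
  obtain a b c where A: "A = rodrigues a b c" using SO3_eq_rodrigues AB tpos by metis
  obtain x y z where B: "B = rodrigues x y z" using SO3_eq_rodrigues AB tpos by metis
  define u v w where "u = a\<^sup>2 + b\<^sup>2 + c\<^sup>2" and "v = x\<^sup>2 + y\<^sup>2 + z\<^sup>2"
    and "w = a * x + b * y + c * z"
  have uv: "0 \<le> u" "0 \<le> v" by (auto simp: u_def v_def)
  have tr: "trace A = 4 / (1 + u) - 1" "trace B = 4 / (1 + v) - 1"
    by (simp_all add: A B trace_rodrigues u_def v_def add.assoc)
  have lt: "u < 1" "v < 1" using t uv unfolding tr by (simp_all add: field_simps)
  have "0 \<le> (a - x)\<^sup>2 + (b - y)\<^sup>2 + (c - z)\<^sup>2" "0 \<le> (a + x)\<^sup>2 + (b + y)\<^sup>2 + (c + z)\<^sup>2" by auto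
  then have w: "2 * w \<le> u + v" "- (2 * w) \<le> u + v"
    by (simp_all add: u_def v_def w_def power2_eq_square algebra_simps)
  have eq: "trace (B - A ** transpose B ** A) = 16 * (1 + w) * (u - w) / ((1 + u)\<^sup>2 * (1 + v))"
    using trace_attraction_rodrigues[OF A B] by (simp add: u_def v_def w_def add.assoc)
  have diff: "trace B - trace A = 4 * (u - v) / ((1 + u) * (1 + v))"
    using uv unfolding tr by (simp add: field_simps)
  have "2 * (1 + w) / (1 + u) * (trace B - trace A) = 16 * (1 + w) * ((u - v) / 2) / ((1 + u)\<^sup>2 * (1 + v))"
  proof -
    have "16 * (1 + w) * ((u - v) / 2) = 2 * (1 + w) * (4 * (u - v))"
      by (simp add: field_simps)
    then show ?thesis by (simp only: diff times_divide_times_eq power2_eq_square mult.assoc)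
  qed
  also have "\<dots> \<le> trace (B - A ** transpose B ** A)"
    unfolding eq using w uv lt by (intro divide_right_mono mult_left_mono) auto
  finally have le: "2 * (1 + w) / (1 + u) * (trace B - trace A) \<le> trace (B - A ** transpose B ** A)" .
  have c: "0 \<le> 2 * (1 + w) / (1 + u)" "2 * (1 + w) / (1 + u) \<le> 4"
    using w uv lt by (auto simp: field_simps)
  show ?thesis
  proof (cases "trace A \<le> trace B")
    case True
    then have "0 \<le> 2 * (1 + w) / (1 + u) * (trace B - trace A)" using c by (intro mult_nonneg_nonneg) auto
    then show ?thesis using le True by simp
  next
    case False
    then have "2 * (1 + w) / (1 + u) * (trace A - trace B) \<le> 4 * (trace A - trace B)"
      using c by (intro mult_right_mono) auto
    moreover have "2 * (1 + w) / (1 + u) * (trace B - trace A) = - (2 * (1 + w) / (1 + u) * (trace A - trace B))"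
      by (metis minus_diff_eq mult_minus_right)
    moreover have "max 0 (trace A - trace B) = trace A - trace B" using False by simp
    ultimately show ?thesis using le by linarith
  qed
qed

text \<open>If both rotation angles are at most \<open>pi / 2 - \<epsilon>\<close> and \<open>s = sin \<epsilon>\<close>, then the angle between
\<open>A\<close> and \<open>B\<close> is at most \<open>pi - 2 * \<epsilon>\<close>, so that \<open>A \<bullet> B \<ge> 1 - 2 * cos (2 * \<epsilon>) = 4 * s\<^sup>2 - 1\<close>.\<close>

lemma SO3_inner_lower_bound:
  assumes AB: "A \<in> SO3" "B \<in> SO3" and s: "0 < s" and t: "1 + 2 * s \<le> trace A" "1 + 2 * s \<le> trace B"
  shows "4 * s\<^sup>2 - 1 \<le> A \<bullet> B"
proof -
  have tpos: "- 1 < trace A" "- 1 < trace B" using t s by auto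
  obtain a b c where A: "A = rodrigues a b c" using SO3_eq_rodrigues AB tpos by metis
  obtain x y z where B: "B = rodrigues x y z" using SO3_eq_rodrigues AB tpos by metis
  define u v w where "u = a\<^sup>2 + b\<^sup>2 + c\<^sup>2" and "v = x\<^sup>2 + y\<^sup>2 + z\<^sup>2"
    and "w = a * x + b * y + c * z"
  have uv: "0 \<le> u" "0 \<le> v" by (auto simp: u_def v_def)
  have tr: "trace A = 4 / (1 + u) - 1" "trace B = 4 / (1 + v) - 1"
    by (simp_all add: A B trace_rodrigues u_def v_def add.assoc)
  have "0 \<le> (a + x)\<^sup>2 + (b + y)\<^sup>2 + (c + z)\<^sup>2" by auto
  then have w: "- (2 * w) \<le> u + v"
    by (simp_all add: u_def v_def w_def power2_eq_square algebra_simps)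
  have h: "(1 + s) * (1 + u) \<le> 2" "(1 + s) * (1 + v) \<le> 2"
    using t uv unfolding tr by (simp_all add: field_simps)
  have sm: "s * (1 + u) \<le> 1 - u" "s * (1 + v) \<le> 1 - v" using h by (simp_all add: algebra_simps)
  have "s * sqrt ((1 + u) * (1 + v)) \<le> s * (((1 + u) + (1 + v)) / 2)"
    using arith_geo_mean_sqrt[of "1 + u" "1 + v"] uv s by (intro mult_left_mono) auto
  also have "\<dots> = (s * (1 + u) + s * (1 + v)) / 2" by (simp add: algebra_simps)
  also have "\<dots> \<le> 1 + w" using sm w by (simp add: field_simps)
  finally have "(s * sqrt ((1 + u) * (1 + v)))\<^sup>2 \<le> (1 + w)\<^sup>2"
    using s uv by (intro power_mono) auto
  then have "s\<^sup>2 * ((1 + u) * (1 + v)) \<le> (1 + w)\<^sup>2" using uv by (simp add: power_mult_distrib)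
  then have "s\<^sup>2 \<le> (1 + w)\<^sup>2 / ((1 + u) * (1 + v))"
    using uv by (subst pos_le_divide_eq) auto
  moreover have "A \<bullet> B = 4 * (1 + w)\<^sup>2 / ((1 + u) * (1 + v)) - 1"
    using inner_rodrigues[of a b c x y z] by (simp add: A B u_def v_def w_def add.assoc)
  ultimately show ?thesis by simp
qed

lemma trace_eq_inner_mat1: "trace (A :: real^'n^'n) = mat 1 \<bullet> A"
  using trace_transpose_mult[of "mat 1" A] by simp

lemma continuous_on_trace [continuous_intros]:
  "continuous_on S f \<Longrightarrow> continuous_on S (\<lambda>x. trace (f x :: real^'n^'n))"
  unfolding trace_eq_inner_mat1 by (intro continuous_intros)

lemma geoball_eq:
  assumes "0 \<le> r" "r \<le> pi"
  shows "geoball r = {Q \<in> SO3. 1 + 2 * cos r < trace Q}"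
proof -
  have "(arccos ((trace Q - 1) / 2) < r) = (1 + 2 * cos r < trace Q)" if "Q \<in> SO3" for Q
  proof -
    have "\<bar>(trace Q - 1) / 2\<bar> \<le> 1" using SO3_trace_bounds[OF that] by (simp add: abs_le_iff)
    then have "(arccos ((trace Q - 1) / 2) < arccos (cos r)) = (cos r < (trace Q - 1) / 2)"
      by (intro arccos_less_mono) auto
    then show ?thesis using assms by (simp add: arccos_cos field_simps)
  qed
  then show ?thesis by (auto simp: geoball_def geodist_def)
qed

lemma closed_SO3: "closed SO3"
proof -
  have eq: "SO3 = {R :: real^3^3. transpose R ** R = mat 1} \<inter> {R. det R = 1}"
    by (auto simp: SO3_iff)
  have "closed {R :: real^3^3. transpose R ** R = mat 1}"
    unfolding mat3 by (intro closed_Collect_conj closed_Collect_eq continuous_intros)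
  moreover have "closed {R :: real^3^3. det R = 1}"
    unfolding det_3 by (intro closed_Collect_eq continuous_intros)
  ultimately show ?thesis unfolding eq by (rule closed_Int)
qed

lemma continuous_on_rodrigues:
  "continuous_on UNIV (\<lambda>s. rodrigues (s * a) (s * b) (s * c))"
proof -
  have inverse: "1 / (1 + x\<^sup>2 + y\<^sup>2 + z\<^sup>2) * (1 + x\<^sup>2 + y\<^sup>2 + z\<^sup>2) = 1" for x y z :: real
    using rodrigues_denom_pos[of x y z] by simp
  have "continuous_on UNIV (\<lambda>s. rodrigues (s * a) (s * b) (s * c) $ i $ j)" for i j
    using exhaust_3[of i] exhaust_3[of j]
    by (elim disjE; simp only: rodrigues_nth[OF inverse]; intro continuous_intros ballI less_imp_neq[OF rodrigues_denom_pos, symmetric])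
  then have "continuous_on UNIV (\<lambda>s. \<chi> i j. rodrigues (s * a) (s * b) (s * c) $ i $ j)"
    by (intro continuous_on_vec_lambda)
  then show ?thesis by (simp add: vec_lambda_eta)
qed

text \<open>For the inclusion from right to left, a rotation \<open>rodrigues a b c\<close> is approached by the rotations with the vectors
\<open>s * (a, b, c)\<close> for \<open>s < 1\<close>, whose angles are smaller unless it is the identity.\<close>

lemma closure_geoball_eq:
  assumes "0 < r" "r < pi"
  shows "closure (geoball r) = {Q \<in> SO3. 1 + 2 * cos r \<le> trace Q}"
proof
  have "closed {Q \<in> SO3. 1 + 2 * cos r \<le> trace Q}"
  proof -
    have "closed {Q :: real^3^3. 1 + 2 * cos r \<le> trace Q}"
      by (intro closed_Collect_le continuous_on_trace continuous_intros)
    from closed_Int[OF closed_SO3 this] show ?thesis by (simp add: Int_def)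
  qed
  then show "closure (geoball r) \<subseteq> {Q \<in> SO3. 1 + 2 * cos r \<le> trace Q}"
    by (rule closure_minimal[rotated]) (use assms in \<open>auto simp: geoball_eq\<close>)
next
  show "{Q \<in> SO3. 1 + 2 * cos r \<le> trace Q} \<subseteq> closure (geoball r)"
  proof
    fix Q assume Q: "Q \<in> {Q \<in> SO3. 1 + 2 * cos r \<le> trace Q}"
    have cr: "cos r > -1" "cos r < 1" using cos_monotone_0_pi[of 0 r] cos_monotone_0_pi[of r pi] assms by auto
    obtain a b c where q: "Q = rodrigues a b c" using Q cr by (auto elim: SO3_eq_rodrigues)
    define u where "u = a\<^sup>2 + b\<^sup>2 + c\<^sup>2"
    have u0: "0 \<le> u" by (simp add: u_def)
    have tq: "trace Q = 4 / (1 + u) - 1" by (simp add: q trace_rodrigues u_def add.assoc)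
    have in_ball: "rodrigues (s * a) (s * b) (s * c) \<in> geoball r" if s: "s \<in> {0..<1}" for s
    proof -
      have *: "trace (rodrigues (s * a) (s * b) (s * c)) = 4 / (1 + s\<^sup>2 * u) - 1"
        by (simp add: trace_rodrigues u_def power_mult_distrib algebra_simps)
      have "1 + 2 * cos r < trace (rodrigues (s * a) (s * b) (s * c))"
      proof (cases "u = 0")
        case True then show ?thesis using cr by (simp add: *)
      next
        case False
        have "s\<^sup>2 < 1" using s by (simp add: abs_square_less_1)
        then have "s\<^sup>2 * u < 1 * u" using u0 False by (intro mult_strict_right_mono) auto
        then have "4 / (1 + u) < 4 / (1 + s\<^sup>2 * u)" using u0 by (intro divide_strict_left_mono) (auto intro!: mult_pos_pos add_pos_nonneg)
        then show ?thesis using Q tq unfolding * by simp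
      qed
      then show ?thesis using assms by (simp add: geoball_eq rodrigues_SO3)
    qed
    have "(\<lambda>s. rodrigues (s * a) (s * b) (s * c)) ` closure {0..<1} \<subseteq> closure (geoball r)"
      by (rule image_closure_subset)
        (use in_ball in \<open>auto intro: continuous_on_subset[OF continuous_on_rodrigues] subsetD[OF closure_subset]\<close>)
    moreover have "(1::real) \<in> closure {0..<1}" by simp
    ultimately show "Q \<in> closure (geoball r)" unfolding q by fastforce
  qed
qed

section \<open>Bounded Lipschitz functions\<close>

text \<open>Bounded and Lipschitz on \<open>X\<close>. Unlike the Lipschitz functions alone, this class is closed under products.\<close>

definition bdd_lipschitz_on :: "'a::metric_space set \<Rightarrow> ('a \<Rightarrow> 'b::real_normed_vector) \<Rightarrow> bool" where
  "bdd_lipschitz_on X f \<longleftrightarrow> (\<exists>L\<ge>0. (\<forall>x\<in>X. norm (f x) \<le> L) \<and>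
     (\<forall>x\<in>X. \<forall>y\<in>X. norm (f x - f y) \<le> L * dist x y))"

lemma bdd_lipschitz_onI:
  assumes "\<And>x. x \<in> X \<Longrightarrow> norm (f x) \<le> M"
    and "\<And>x y. x \<in> X \<Longrightarrow> y \<in> X \<Longrightarrow> norm (f x - f y) \<le> L * dist x y"
  shows "bdd_lipschitz_on X f"
  unfolding bdd_lipschitz_on_def
proof (intro exI[of _ "max 0 (max L M)"] conjI ballI)
  fix x assume "x \<in> X"
  then show "norm (f x) \<le> max 0 (max L M)" using assms(1)[of x] by linarith
next
  fix x y assume "x \<in> X" "y \<in> X"
  then have "norm (f x - f y) \<le> L * dist x y" by (rule assms(2))
  also have "\<dots> \<le> max 0 (max L M) * dist x y" by (intro mult_right_mono) auto
  finally show "norm (f x - f y) \<le> max 0 (max L M) * dist x y" .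
qed simp

lemma bdd_lipschitz_on_bilinear:
  assumes "bounded_bilinear p" and f: "bdd_lipschitz_on X f" and g: "bdd_lipschitz_on X g"
  shows "bdd_lipschitz_on X (\<lambda>x. p (f x) (g x))"
proof -
  interpret bounded_bilinear p by fact
  obtain K where K: "0 \<le> K" "\<And>a b. norm (p a b) \<le> norm a * norm b * K"
    using nonneg_bounded by blast
  obtain L where L: "0 \<le> L" "\<And>x. x \<in> X \<Longrightarrow> norm (f x) \<le> L"
    "\<And>x y. x \<in> X \<Longrightarrow> y \<in> X \<Longrightarrow> norm (f x - f y) \<le> L * dist x y"
    using f unfolding bdd_lipschitz_on_def by blast
  obtain M where M: "0 \<le> M" "\<And>x. x \<in> X \<Longrightarrow> norm (g x) \<le> M"
    "\<And>x y. x \<in> X \<Longrightarrow> y \<in> X \<Longrightarrow> norm (g x - g y) \<le> M * dist x y"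
    using g unfolding bdd_lipschitz_on_def by blast
  show ?thesis
  proof (rule bdd_lipschitz_onI[where M="L * M * K" and L="2 * (L * M * K)"])
    fix x assume x: "x \<in> X"
    have "norm (p (f x) (g x)) \<le> norm (f x) * norm (g x) * K" by (rule K)
    also have "\<dots> \<le> L * M * K" using x L M K by (intro mult_right_mono mult_mono) auto
    finally show "norm (p (f x) (g x)) \<le> L * M * K" .
  next
    fix x y assume xy: "x \<in> X" "y \<in> X"
    have "p (f x) (g x) - p (f y) (g y) = p (f x - f y) (g x) + p (f y) (g x - g y)"
      by (simp add: diff_left diff_right)
    also have "norm \<dots> \<le> norm (f x - f y) * norm (g x) * K + norm (f y) * norm (g x - g y) * K"
      by (intro norm_triangle_le add_mono K)
    also have "\<dots> \<le> (L * dist x y) * M * K + L * (M * dist x y) * K"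
      using xy L M K by (intro add_mono mult_right_mono mult_mono) auto
    finally show "norm (p (f x) (g x) - p (f y) (g y)) \<le> 2 * (L * M * K) * dist x y"
      by (simp add: algebra_simps)
  qed
qed

lemma bdd_lipschitz_on_diff:
  assumes f: "bdd_lipschitz_on X f" and g: "bdd_lipschitz_on X g"
  shows "bdd_lipschitz_on X (\<lambda>x. f x - g x)"
proof -
  obtain L where L: "0 \<le> L" "\<And>x. x \<in> X \<Longrightarrow> norm (f x) \<le> L"
    "\<And>x y. x \<in> X \<Longrightarrow> y \<in> X \<Longrightarrow> norm (f x - f y) \<le> L * dist x y"
    using f unfolding bdd_lipschitz_on_def by blast
  obtain M where M: "0 \<le> M" "\<And>x. x \<in> X \<Longrightarrow> norm (g x) \<le> M"
    "\<And>x y. x \<in> X \<Longrightarrow> y \<in> X \<Longrightarrow> norm (g x - g y) \<le> M * dist x y"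
    using g unfolding bdd_lipschitz_on_def by blast
  show ?thesis
  proof (rule bdd_lipschitz_onI[where M="L + M" and L="L + M"])
    fix x assume "x \<in> X"
    then show "norm (f x - g x) \<le> L + M"
      using L(2) M(2) by (intro norm_triangle_le_diff add_mono)
  next
    fix x y assume xy: "x \<in> X" "y \<in> X"
    have "f x - g x - (f y - g y) = (f x - f y) - (g x - g y)" by simp
    also have "norm \<dots> \<le> L * dist x y + M * dist x y"
      using L(3)[OF xy] M(3)[OF xy] by (rule order_trans[OF norm_triangle_ineq4 add_mono])
    finally show "norm (f x - g x - (f y - g y)) \<le> (L + M) * dist x y" by (simp add: algebra_simps)
  qed
qed

lemma bdd_lipschitz_on_compose:
  assumes f: "bdd_lipschitz_on Y f" and g: "\<And>x. x \<in> X \<Longrightarrow> g x \<in> Y"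
    and lip: "\<And>x y. x \<in> X \<Longrightarrow> y \<in> X \<Longrightarrow> dist (g x) (g y) \<le> C * dist x y"
  shows "bdd_lipschitz_on X (\<lambda>x. f (g x))"
proof -
  obtain L where L: "0 \<le> L" "\<And>x. x \<in> Y \<Longrightarrow> norm (f x) \<le> L"
    "\<And>x y. x \<in> Y \<Longrightarrow> y \<in> Y \<Longrightarrow> norm (f x - f y) \<le> L * dist x y"
    using f unfolding bdd_lipschitz_on_def by blast
  show ?thesis
  proof (rule bdd_lipschitz_onI[where M=L and L="L * C"])
    fix x y assume xy: "x \<in> X" "y \<in> X"
    have "norm (f (g x) - f (g y)) \<le> L * dist (g x) (g y)" using L g xy by auto
    also have "\<dots> \<le> L * (C * dist x y)" using lip[OF xy] L by (intro mult_left_mono) auto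
    finally show "norm (f (g x) - f (g y)) \<le> L * C * dist x y" by (simp add: mult.assoc)
  qed (use L g in auto)
qed

lemma bdd_lipschitz_on_compact_interval:
  fixes f :: "real \<Rightarrow> real"
  assumes cont: "continuous_on {a..b} f"
    and der: "\<And>x. a < x \<Longrightarrow> x < b \<Longrightarrow> (f has_real_derivative f' x) (at x)"
    and bd: "\<And>x. a < x \<Longrightarrow> x < b \<Longrightarrow> \<bar>f' x\<bar> \<le> L"
  shows "bdd_lipschitz_on {a..b} f"
proof -
  have "bounded (f ` {a..b})"
    using cont by (intro compact_imp_bounded compact_continuous_image) auto
  then obtain M where M: "\<And>x. x \<in> {a..b} \<Longrightarrow> norm (f x) \<le> M"
    unfolding bounded_iff by blast
  have le: "norm (f y - f x) \<le> L * dist x y" if "x \<in> {a..b}" "y \<in> {a..b}" "x < y" for x y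
  proof -
    have "\<exists>l z. x < z \<and> z < y \<and> (f has_real_derivative l) (at z) \<and> f y - f x = (y - x) * l"
    proof (rule MVT[OF that(3)])
      show "continuous_on {x..y} f" using cont by (rule continuous_on_subset) (use that in auto)
      show "f differentiable (at z)" if "x < z" "z < y" for z
        using der[of z] that \<open>x \<in> {a..b}\<close> \<open>y \<in> {a..b}\<close> by (auto simp: real_differentiable_def)
    qed
    then obtain l z where z: "x < z" "z < y" "(f has_real_derivative l) (at z)" "f y - f x = (y - x) * l"
      by blast
    then have "l = f' z" using der[of z] that by (intro DERIV_unique) auto
    then have "\<bar>l\<bar> \<le> L" using bd[of z] z that by auto
    then show ?thesis using z that by (simp add: abs_mult dist_real_def mult.commute mult_left_mono)
  qed
  show ?thesis
  proof (rule bdd_lipschitz_onI[OF M])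
    fix x y assume "x \<in> {a..b}" "y \<in> {a..b}"
    then show "norm (f x - f y) \<le> L * dist x y"
      using le[of x y] le[of y x] by (cases x y rule: linorder_cases) (auto simp: dist_commute norm_minus_commute)
  qed
qed

section \<open>The radial profile of the interaction kernel\<close>

lemma sinc_pos: "0 \<le> \<theta> \<Longrightarrow> \<theta> < pi \<Longrightarrow> 0 < sinc \<theta>"
  by (auto simp: sin_gt_zero)

lemma continuous_on_sinc_arccos: "continuous_on {-1..1} (\<lambda>y. sinc (arccos y))"
  by (intro continuous_on_sinc continuous_on_arccos')

lemma arccos_range: "-1 < y \<Longrightarrow> y \<le> 1 \<Longrightarrow> 0 \<le> arccos y \<and> arccos y < pi"
  using arccos_lt_bounded[of y] arccos_1 by (cases "y = 1") auto

text \<open>Although \<open>arccos\<close> has no derivative at \<open>1\<close>, its square has the one-sided derivative \<open>- 2\<close> there; recall that \<open>sinc 0 = 1\<close>.\<close>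

lemma arccos_square_has_derivative:
  assumes y: "-1 < y" "y \<le> 1"
  shows "((\<lambda>y. (arccos y)\<^sup>2) has_real_derivative (- 2 / sinc (arccos y))) (at y within {-1..1})"
proof (cases "y = 1")
  case False
  then have y': "-1 < y" "y < 1" using y by auto
  have s: "sqrt (1 - y\<^sup>2) = sin (arccos y)" using y' by (simp add: sin_arccos_abs abs_le_iff)
  have "0 < arccos y" using y' by (simp add: arccos_lt_bounded)
  moreover have "((\<lambda>y. (arccos y)\<^sup>2) has_real_derivative 2 * arccos y * inverse (- sqrt (1 - y\<^sup>2))) (at y)"
    using y' by (auto intro!: derivative_eq_intros)
  ultimately show ?thesis
    by (auto simp: s field_simps elim: has_field_derivative_at_within)
next
  case True
  have "((\<lambda>z. - 2 / (sinc (arccos z / 2))\<^sup>2) \<longlongrightarrow> - 2 / (sinc (arccos 1 / 2))\<^sup>2) (at 1 within {-1..1})"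
  proof -
    have "continuous_on {-1..1} (\<lambda>z. sinc (arccos z / 2))"
      by (intro continuous_on_sinc continuous_on_divide continuous_on_arccos' continuous_on_const) auto
    then have "((\<lambda>z. sinc (arccos z / 2)) \<longlongrightarrow> sinc (arccos 1 / 2)) (at 1 within {-1..1})"
      unfolding continuous_on_def by (rule bspec) simp
    then show ?thesis by (intro tendsto_intros) auto
  qed
  then have "((\<lambda>z. - 2 / (sinc (arccos z / 2))\<^sup>2) \<longlongrightarrow> - 2) (at 1 within {-1..1})" by simp
  then have "((\<lambda>z. ((arccos z)\<^sup>2 - (arccos 1)\<^sup>2) / (z - 1)) \<longlongrightarrow> - 2) (at 1 within {-1..1})"
  proof (rule Lim_transform_eventually)
    show "\<forall>\<^sub>F z in at 1 within {- 1..1}. - 2 / (sinc (arccos z / 2))\<^sup>2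
       = ((arccos z)\<^sup>2 - (arccos 1)\<^sup>2) / (z - 1)"
      unfolding eventually_at_filter
    proof (intro always_eventually allI impI)
      fix z :: real assume z: "z \<noteq> 1" "z \<in> {- 1..1}"
      have "0 < arccos z" using z arccos_less_arccos[of z 1] by auto
      moreover have "z - 1 = - (2 * (sin (arccos z / 2))\<^sup>2)"
        using cos_double_sin[of "arccos z / 2"] z by simp
      ultimately show "- 2 / (sinc (arccos z / 2))\<^sup>2 = ((arccos z)\<^sup>2 - (arccos 1)\<^sup>2) / (z - 1)"
        by (simp add: power_divide)
    qed
  qed
  then show ?thesis using True by (simp add: has_field_derivative_iff)
qed

text \<open>The derivative \<open>- (sin \<theta> - \<theta> * cos \<theta>) / (sin \<theta>) ^ 3\<close> with respect to \<open>cos \<theta>\<close> is bounded near \<open>\<theta> = 0\<close> because the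
numerator is \<open>O(\<theta> ^ 3)\<close>.\<close>

lemma bdd_lipschitz_on_inverse_sinc_arccos:
  assumes a: "- 1 < a" "a \<le> 1"
  shows "bdd_lipschitz_on {a..1} (\<lambda>y. 1 / sinc (arccos y))"
proof -
  have cont: "continuous_on {a..1} (\<lambda>y. 1 / sinc (arccos y))"
  proof (intro continuous_on_divide continuous_on_const ballI)
    show "continuous_on {a..1} (\<lambda>y. sinc (arccos y))"
      using continuous_on_sinc_arccos by (rule continuous_on_subset) (use a in auto)
    fix y assume "y \<in> {a..1}"
    then show "sinc (arccos y) \<noteq> 0" using sinc_pos[of "arccos y"] arccos_range[of y] a by auto
  qed
  then have "bounded ((\<lambda>y. 1 / sinc (arccos y)) ` {a..1})"
    by (intro compact_imp_bounded compact_continuous_image) auto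
  then obtain S where S: "\<And>y. y \<in> {a..1} \<Longrightarrow> norm (1 / sinc (arccos y)) \<le> S"
    unfolding bounded_iff by blast
  show ?thesis
  proof (rule bdd_lipschitz_on_compact_interval[OF cont, where L="S ^ 3" and
        f'="\<lambda>y. - (sin (arccos y) - arccos y * cos (arccos y)) / (sin (arccos y)) ^ 3"])
    fix y assume y: "a < y" "y < 1"
    define \<theta> where "\<theta> = arccos y"
    have \<theta>: "0 < \<theta>" "\<theta> < pi" using arccos_lt_bounded[of y] y a by (auto simp: \<theta>_def)
    have sp: "0 < sin \<theta>" using \<theta> by (rule sin_gt_zero)
    have sq: "sqrt (1 - y\<^sup>2) = sin \<theta>" using y a by (simp add: sin_arccos_abs abs_le_iff \<theta>_def)
    have "((\<lambda>y. arccos y / sin (arccos y)) has_real_derivative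
      (inverse (- sqrt (1 - y\<^sup>2)) * sin \<theta> - \<theta> * (cos \<theta> * inverse (- sqrt (1 - y\<^sup>2)))) / (sin \<theta> * sin \<theta>)) (at y)"
      using y a sp by (auto intro!: derivative_eq_intros simp: \<theta>_def)
    also have "(inverse (- sqrt (1 - y\<^sup>2)) * sin \<theta> - \<theta> * (cos \<theta> * inverse (- sqrt (1 - y\<^sup>2)))) / (sin \<theta> * sin \<theta>)
      = - (sin \<theta> - \<theta> * cos \<theta>) / (sin \<theta>) ^ 3"
      unfolding sq using sp by (simp add: field_simps power3_eq_cube)
    finally have "((\<lambda>y. arccos y / sin (arccos y)) has_real_derivative
      - (sin \<theta> - \<theta> * cos \<theta>) / (sin \<theta>) ^ 3) (at y)" .
    then show "((\<lambda>y. 1 / sinc (arccos y)) has_real_derivative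
        - (sin (arccos y) - arccos y * cos (arccos y)) / (sin (arccos y)) ^ 3) (at y)"
      unfolding \<theta>_def
    proof (rule has_field_derivative_transform_within_open)
      show "open {a<..<1}" "y \<in> {a<..<1}" using y by auto
      fix z assume "z \<in> {a<..<1}"
      then have "0 < arccos z" using arccos_lt_bounded[of z] a by auto
      then show "arccos z / sin (arccos z) = 1 / sinc (arccos z)" by simp
    qed
    have le: "\<bar>sin \<theta> - \<theta> * cos \<theta>\<bar> \<le> \<theta> ^ 3"
    proof -
      have "\<theta> * cos \<theta> \<le> sin \<theta>"
      proof (rule DERIV_nonneg_imp_nondecreasing[of 0 \<theta> "\<lambda>t. sin t - t * cos t", simplified])
        show "0 \<le> \<theta>" using \<theta> by simp
        fix x assume "0 \<le> x" "x \<le> \<theta>"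
        then show "\<exists>d. ((\<lambda>t. sin t - t * cos t) has_real_derivative d) (at x) \<and> 0 \<le> d"
          using \<theta> by (intro exI[of _ "x * sin x"]) (auto intro!: derivative_eq_intros mult_nonneg_nonneg sin_ge_zero)
      qed
      moreover have "sin \<theta> - \<theta> * cos \<theta> \<le> \<theta> ^ 3"
      proof -
        have "sin \<theta> \<le> \<theta>" using \<theta> by (intro sin_x_le_x) auto
        moreover have "\<theta> * (1 - \<theta>\<^sup>2 / 2) \<le> \<theta> * cos \<theta>"
        proof -
          have "(sin (\<theta> / 2))\<^sup>2 \<le> (\<theta> / 2)\<^sup>2"
            using \<theta> by (intro power_mono sin_x_le_x sin_ge_zero) auto
          then have "1 - \<theta>\<^sup>2 / 2 \<le> cos \<theta>"
            using cos_double_sin[of "\<theta> / 2"] by (simp add: power_divide)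
          then show ?thesis using \<theta> by (intro mult_left_mono) auto
        qed
        ultimately have "sin \<theta> - \<theta> * cos \<theta> \<le> \<theta> ^ 3 / 2"
          by (simp add: algebra_simps power2_eq_square power3_eq_cube)
        then show ?thesis using \<theta> by (smt (verit) zero_less_power field_sum_of_halves)
      qed
      ultimately show ?thesis by linarith
    qed
    have "\<theta> / sin \<theta> \<le> S" using S[of y] y a \<theta> sp by (auto simp: \<theta>_def)
    then have "(\<theta> / sin \<theta>) ^ 3 \<le> S ^ 3" using \<theta> sp by (intro power_mono) auto
    moreover have "\<bar>sin \<theta> - \<theta> * cos \<theta>\<bar> / (sin \<theta>) ^ 3 \<le> (\<theta> / sin \<theta>) ^ 3"
      using le sp by (simp add: power_divide divide_right_mono)
    ultimately show "\<bar>- (sin (arccos y) - arccos y * cos (arccos y)) / (sin (arccos y)) ^ 3\<bar> \<le> S ^ 3"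
      using sp by (simp add: \<theta>_def[symmetric] abs_divide abs_minus_commute)
  qed
qed

lemma bdd_lipschitz_on_arccos_square:
  assumes a: "- 1 < a" "a \<le> 1"
  shows "bdd_lipschitz_on {a..1} (\<lambda>y. (arccos y)\<^sup>2)"
proof -
  obtain L where L: "\<And>y. y \<in> {a..1} \<Longrightarrow> norm (1 / sinc (arccos y)) \<le> L"
    using bdd_lipschitz_on_inverse_sinc_arccos[OF a] unfolding bdd_lipschitz_on_def by blast
  show ?thesis
  proof (rule bdd_lipschitz_on_compact_interval[where L="2 * L" and f'="\<lambda>y. - 2 / sinc (arccos y)"])
    show "continuous_on {a..1} (\<lambda>y. (arccos y)\<^sup>2)"
      by (intro continuous_intros continuous_on_subset[OF continuous_on_arccos']) (use a in auto)
    fix y assume y: "a < y" "y < 1"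
    have "((\<lambda>y. (arccos y)\<^sup>2) has_real_derivative (- 2 / sinc (arccos y))) (at y within {-1..1})"
      using y a by (intro arccos_square_has_derivative) auto
    moreover have "at y within {-1..1} = at y"
      using y a by (intro at_within_interior) (auto simp: interior_atLeastAtMost_real)
    ultimately show "((\<lambda>y. (arccos y)\<^sup>2) has_real_derivative (- 2 / sinc (arccos y))) (at y)" by metis
    show "\<bar>- 2 / sinc (arccos y)\<bar> \<le> 2 * L" using L[of y] y a by (simp add: abs_divide del: divide_minus_left)
  qed
qed

text \<open>Minus the derivative of \<open>x \<mapsto> g (\<theta>\<^sup>2)\<close>, where \<open>\<theta>\<close> is the distance of two rotations \<open>R\<close> and \<open>Q\<close> with \<open>R \<bullet> Q = x\<close>.
In terms of \<open>\<theta>\<close> it is \<open>g' (\<theta>\<^sup>2) * \<theta> / sin \<theta>\<close>, and \<open>g' 0\<close> if \<open>\<theta> = 0\<close>.\<close>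

definition kernel_coeff :: "(real \<Rightarrow> real) \<Rightarrow> real \<Rightarrow> real" where
  "kernel_coeff g' x = g' ((arccos ((x - 1) / 2))\<^sup>2) * (1 / sinc (arccos ((x - 1) / 2)))"

lemma kernel_coeff_nonneg:
  assumes "\<And>s. 0 \<le> s \<Longrightarrow> 0 \<le> g' s" "- 1 < x" "x \<le> 3"
  shows "0 \<le> kernel_coeff g' x"
  unfolding kernel_coeff_def using assms sinc_pos[of "arccos ((x - 1) / 2)"] arccos_range[of "(x - 1) / 2"]
  by (intro mult_nonneg_nonneg) auto

lemma bdd_lipschitz_on_kernel_coeff:
  assumes loc: "local_lipschitz (UNIV :: real set) {0..} (\<lambda>_. g')" and a: "- 1 < a" "a \<le> 3"
  shows "bdd_lipschitz_on {a..3} (kernel_coeff g')"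
proof -
  let ?y = "\<lambda>x::real. (x - 1) / 2"
  have Y: "?y x \<in> {?y a..1}" if "x \<in> {a..3}" for x using that by auto
  have Ylip: "dist (?y x) (?y y) \<le> (1/2) * dist x y" for x y
    by (simp add: dist_real_def flip: diff_divide_distrib)
  have ya: "- 1 < ?y a" "?y a \<le> 1" using a by auto
  have sq: "bdd_lipschitz_on {a..3} (\<lambda>x. (arccos (?y x))\<^sup>2)"
    by (rule bdd_lipschitz_on_compose[OF bdd_lipschitz_on_arccos_square[OF ya] Y Ylip])
  have si: "bdd_lipschitz_on {a..3} (\<lambda>x. 1 / sinc (arccos (?y x)))"
    by (rule bdd_lipschitz_on_compose[OF bdd_lipschitz_on_inverse_sinc_arccos[OF ya] Y Ylip])
  have "local_lipschitz {0::real} {0..pi\<^sup>2} (\<lambda>_. g')"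
    using local_lipschitz_subset[OF loc, of "{0}" "{0..pi\<^sup>2}"] by auto
  moreover have cont: "continuous_on {0} (\<lambda>_. g' x)" if "x \<in> {0..pi\<^sup>2}" for x by simp
  ultimately obtain L where L: "L-lipschitz_on {0..pi\<^sup>2} g'"
    using local_lipschitz_compact_implies_lipschitz[of "{0::real}" "{0..pi\<^sup>2}" "\<lambda>_. g'"] by auto
  then have "bounded (g' ` {0..pi\<^sup>2})"
    by (intro compact_imp_bounded compact_continuous_image lipschitz_on_continuous_on) auto
  then obtain M where M: "\<And>y. y \<in> {0..pi\<^sup>2} \<Longrightarrow> norm (g' y) \<le> M"
    unfolding bounded_iff by blast
  have g: "bdd_lipschitz_on {0..pi\<^sup>2} g'"
    using lipschitz_onD[OF L] by (intro bdd_lipschitz_onI[OF M]) (auto simp: dist_norm)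
  obtain C where C: "\<And>x y. x \<in> {a..3} \<Longrightarrow> y \<in> {a..3} \<Longrightarrow>
      dist ((arccos (?y x))\<^sup>2) ((arccos (?y y))\<^sup>2) \<le> C * dist x y"
    using sq unfolding bdd_lipschitz_on_def dist_norm by blast
  have "bdd_lipschitz_on {a..3} (\<lambda>x. g' ((arccos (?y x))\<^sup>2))"
  proof (rule bdd_lipschitz_on_compose[OF g _ C])
    fix x assume "x \<in> {a..3}"
    then show "(arccos (?y x))\<^sup>2 \<in> {0..pi\<^sup>2}"
      using arccos_range[of "?y x"] a by (auto intro!: power_mono)
  qed
  from bdd_lipschitz_on_bilinear[OF bounded_bilinear_mult this si] show ?thesis
    by (simp add: kernel_coeff_def[abs_def])
qed

lemma kernel_profile_has_derivative:
  assumes g: "\<And>s. 0 \<le> s \<Longrightarrow> (g has_real_derivative g' s) (at s within {0..})"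
    and x: "- 1 < x" "x \<le> 3"
  shows "((\<lambda>x. g ((arccos ((x - 1) / 2))\<^sup>2)) has_real_derivative - kernel_coeff g' x) (at x within {-1..3})"
proof -
  let ?y = "\<lambda>x::real. (x - 1) / 2"
  have "((\<lambda>y. (arccos y)\<^sup>2) has_real_derivative (- 2 / sinc (arccos (?y x)))) (at (?y x) within {-1..1})"
    using x by (intro arccos_square_has_derivative) auto
  then have "((\<lambda>y. (arccos y)\<^sup>2) has_real_derivative (- 2 / sinc (arccos (?y x)))) (at (?y x) within ?y ` {-1..3})"
    by (rule has_field_derivative_subset) auto
  moreover have "(?y has_real_derivative 1 / 2) (at x within {-1..3})"
    by (auto intro!: derivative_eq_intros)
  ultimately have "((\<lambda>y. (arccos y)\<^sup>2) \<circ> ?y has_real_derivative - 2 / sinc (arccos (?y x)) * (1 / 2)) (at x within {-1..3})"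
    by (rule DERIV_image_chain)
  moreover have "(g has_real_derivative g' ((arccos (?y x))\<^sup>2))
      (at (((\<lambda>y. (arccos y)\<^sup>2) \<circ> ?y) x) within ((\<lambda>y. (arccos y)\<^sup>2) \<circ> ?y) ` {-1..3})"
    unfolding o_apply by (rule has_field_derivative_subset[OF g]) auto
  ultimately have "(g \<circ> ((\<lambda>y. (arccos y)\<^sup>2) \<circ> ?y) has_real_derivative
      g' ((arccos (?y x))\<^sup>2) * (- 2 / sinc (arccos (?y x)) * (1 / 2))) (at x within {-1..3})"
    by (rule DERIV_image_chain[rotated])
  then show ?thesis by (simp add: o_def kernel_coeff_def)
qed

section \<open>The Riemannian gradient of the kernel\<close>

text \<open>The entries \<open>A$3$2\<close>, \<open>A$1$3\<close> and \<open>A$2$1\<close> form the axial vector of the skew matrix \<open>A\<close>.\<close>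

lemma rodrigues_skew:
  fixes A :: "real^3^3"
  assumes A: "transpose A = - A"
  shows "rodrigues (s * A$3$2) (s * A$1$3) (s * A$2$1) = mat 1 +
     (2 * s / (1 + s\<^sup>2 * ((A$3$2)\<^sup>2 + (A$1$3)\<^sup>2 + (A$2$1)\<^sup>2))) *\<^sub>R A +
     (2 * s\<^sup>2 / (1 + s\<^sup>2 * ((A$3$2)\<^sup>2 + (A$1$3)\<^sup>2 + (A$2$1)\<^sup>2))) *\<^sub>R (A ** A)"
proof -
  have e: "A $ i $ j = - A $ j $ i" for i j
    using arg_cong[OF A, of "\<lambda>B. B $ j $ i"] by (simp add: transpose_def)
  have d: "A$1$1 = 0" "A$2$2 = 0" "A$3$3 = 0" using e[of 1 1] e[of 2 2] e[of 3 3] by auto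
  have o: "A$2$3 = - A$3$2" "A$3$1 = - A$1$3" "A$1$2 = - A$2$1" by (rule e)+
  define a b c where "a = A$3$2" and "b = A$1$3" and "c = A$2$1"
  obtain n where n: "n * (1 + (s * a)\<^sup>2 + (s * b)\<^sup>2 + (s * c)\<^sup>2) = 1"
    by (rule rodrigues_scale)
  note e = rodrigues_nth[OF n]
  have q: "x / (1 + s\<^sup>2 * (a\<^sup>2 + b\<^sup>2 + c\<^sup>2)) = x * n" for x
  proof -
    have N: "1 + s\<^sup>2 * (a\<^sup>2 + b\<^sup>2 + c\<^sup>2) = 1 + (s * a)\<^sup>2 + (s * b)\<^sup>2 + (s * c)\<^sup>2"
      by (simp add: algebra_simps power_mult_distrib)
    have "x / (1 + (s * a)\<^sup>2 + (s * b)\<^sup>2 + (s * c)\<^sup>2)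
        = x * (n * (1 + (s * a)\<^sup>2 + (s * b)\<^sup>2 + (s * c)\<^sup>2)) / (1 + (s * a)\<^sup>2 + (s * b)\<^sup>2 + (s * c)\<^sup>2)"
      unfolding n by simp
    also have "\<dots> = x * n" using rodrigues_denom_pos[of "s * a" "s * b" "s * c"] by simp
    finally show ?thesis unfolding N .
  qed
  have dg: "n * (1 + (s * a)\<^sup>2 - (s * b)\<^sup>2 - (s * c)\<^sup>2) = 1 - 2 * n * ((s * b)\<^sup>2 + (s * c)\<^sup>2)"
    "n * (1 - (s * a)\<^sup>2 + (s * b)\<^sup>2 - (s * c)\<^sup>2) = 1 - 2 * n * ((s * a)\<^sup>2 + (s * c)\<^sup>2)"
    "n * (1 - (s * a)\<^sup>2 - (s * b)\<^sup>2 + (s * c)\<^sup>2) = 1 - 2 * n * ((s * a)\<^sup>2 + (s * b)\<^sup>2)"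
    using n by algebra+
  have E: "A$1$1 = 0" "A$1$2 = - c" "A$1$3 = b" "A$2$1 = c" "A$2$2 = 0" "A$2$3 = - a"
      "A$3$1 = - b" "A$3$2 = a" "A$3$3 = 0"
    using d o by (simp_all add: a_def b_def c_def)
  have AA: "(A ** A)$1$1 = - (b\<^sup>2 + c\<^sup>2)" "(A ** A)$1$2 = a * b" "(A ** A)$1$3 = a * c"
      "(A ** A)$2$1 = a * b" "(A ** A)$2$2 = - (a\<^sup>2 + c\<^sup>2)" "(A ** A)$2$3 = b * c"
      "(A ** A)$3$1 = a * c" "(A ** A)$3$2 = b * c" "(A ** A)$3$3 = - (a\<^sup>2 + b\<^sup>2)"
    by (simp_all add: matrix_matrix_mult_def sum_3 E power2_eq_square)
  have I: "(mat 1 :: real^3^3) $ 1 $ 1 = (1::real)" "(mat 1 :: real^3^3) $ 2 $ 2 = (1::real)" "(mat 1 :: real^3^3) $ 3 $ 3 = (1::real)"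
      "(mat 1 :: real^3^3) $ 1 $ 2 = (0::real)" "(mat 1 :: real^3^3) $ 1 $ 3 = (0::real)" "(mat 1 :: real^3^3) $ 2 $ 1 = (0::real)"
      "(mat 1 :: real^3^3) $ 2 $ 3 = (0::real)" "(mat 1 :: real^3^3) $ 3 $ 1 = (0::real)" "(mat 1 :: real^3^3) $ 3 $ 2 = (0::real)"
    by (simp_all add: mat_def)
  show ?thesis
    unfolding a_def[symmetric] b_def[symmetric] c_def[symmetric] q real_scaleR_def vec_eq_iff forall_3
      vector_add_component vector_scaleR_component e dg I E AA
    by (simp add: algebra_simps power2_eq_square)
qed

lemma rodrigues_skew_has_derivative:
  fixes A :: "real^3^3"
  assumes A: "transpose A = - A"
  shows "((\<lambda>s. rodrigues (s * A$3$2) (s * A$1$3) (s * A$2$1)) has_vector_derivative 2 *\<^sub>R A) (at 0)"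
proof -
  define u where "u = (A$3$2)\<^sup>2 + (A$1$3)\<^sup>2 + (A$2$1)\<^sup>2"
  have "((\<lambda>s::real. 2 * s / (1 + s\<^sup>2 * u)) has_real_derivative 2) (at 0)"
    "((\<lambda>s::real. 2 * s\<^sup>2 / (1 + s\<^sup>2 * u)) has_real_derivative 0) (at 0)"
    by (auto intro!: derivative_eq_intros)
  then have "((\<lambda>s. mat 1 + (2 * s / (1 + s\<^sup>2 * u)) *\<^sub>R A + (2 * s\<^sup>2 / (1 + s\<^sup>2 * u)) *\<^sub>R (A ** A))
      has_vector_derivative 0 + 2 *\<^sub>R A + 0 *\<^sub>R (A ** A)) (at 0)"
    by (intro has_vector_derivative_add has_vector_derivative_const
        bounded_linear.has_vector_derivative[OF bounded_linear_scaleR_left])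
      (simp_all add: has_real_derivative_iff_has_vector_derivative)
  then show ?thesis unfolding rodrigues_skew[OF A] u_def by simp
qed

lemma transpose_mult_inner: "(transpose A ** B) \<bullet> C = B \<bullet> (A ** C)"
  for A B C :: "real^'n^'n"
proof -
  have "trace (transpose B ** A ** C) = trace (transpose B ** (A ** C))" by (simp add: matrix_mul_assoc)
  then show ?thesis
    unfolding trace_transpose_mult[of "transpose A ** B" C, symmetric] trace_transpose_mult[of B "A ** C", symmetric]
      matrix_transpose_mul transpose_transpose .
qed

lemma inner_transpose: "transpose A \<bullet> transpose B = A \<bullet> (B :: real^'n^'n)"
  unfolding inner_vec_def transpose_def by (simp, rule sum.swap)

lemma bounded_bilinear_matrix_mult: "bounded_bilinear ((**) :: real^'n^'n \<Rightarrow> real^'n^'n \<Rightarrow> real^'n^'n)"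
  unfolding bilinear_conv_bounded_bilinear[symmetric] bilinear_def
  by (auto intro!: linearI simp: vec_eq_iff matrix_matrix_mult_def algebra_simps sum.distrib sum_distrib_left)

lemma SO3_inverse: "R \<in> SO3 \<Longrightarrow> transpose R ** R = mat 1" "R \<in> SO3 \<Longrightarrow> R ** transpose R = mat 1"
  by (auto simp: SO3_iff matrix_left_right_inverse)

text \<open>The derivative within \<open>SO3\<close> is not unique as a map on all matrices, but it is determined on the tangent space
of \<open>R\<close>, because each tangent direction is the velocity of a curve \<open>s \<mapsto> R ** rodrigues (s * a) (s * b) (s * c)\<close>
of rotations.\<close>

lemma is_grad_SO3_unique:
  assumes R: "R \<in> SO3" and G: "is_grad_SO3 f R G" and H: "is_grad_SO3 f R H"
  shows "G = H"
proof -
  obtain D where D: "(f has_derivative D) (at R within SO3)"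
      "\<And>V. V \<in> tangent_SO3 R \<Longrightarrow> metric_SO3 R G V = D V" and G_tan: "G \<in> tangent_SO3 R"
    using G by (auto simp: is_grad_SO3_def)
  obtain E where E: "(f has_derivative E) (at R within SO3)"
      "\<And>V. V \<in> tangent_SO3 R \<Longrightarrow> metric_SO3 R H V = E V" and H_tan: "H \<in> tangent_SO3 R"
    using H by (auto simp: is_grad_SO3_def)
  obtain A B where A: "G = R ** A" "transpose A = - A" and B: "H = R ** B" "transpose B = - B"
    using G_tan H_tan by (auto simp: tangent_SO3_def)
  define W where "W = A - B"
  have W: "transpose W = - W"
  proof -
    have "transpose W = transpose A - transpose B" by (simp add: W_def transpose_def vec_eq_iff)
    then show ?thesis unfolding A(2) B(2) W_def by simp
  qed
  have metric: "metric_SO3 R (R ** X) (R ** Y) = (X \<bullet> Y) / 2" for X Y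
    unfolding metric_SO3_def matrix_mul_assoc SO3_inverse(1)[OF R] by simp
  define \<gamma> where "\<gamma> s = R ** rodrigues (s * W$3$2) (s * W$1$3) (s * W$2$1)" for s
  have \<gamma>0: "\<gamma> 0 = R" using rodrigues_skew[OF W, of 0] by (simp add: \<gamma>_def)
  have \<gamma>': "(\<gamma> has_derivative (\<lambda>s. s *\<^sub>R (R ** (2 *\<^sub>R W)))) (at 0)"
    unfolding \<gamma>_def has_vector_derivative_def[symmetric]
    by (rule bounded_linear.has_vector_derivative[OF
        bounded_bilinear.bounded_linear_right[OF bounded_bilinear_matrix_mult] rodrigues_skew_has_derivative[OF W]])
  have comp: "((\<lambda>s. f (\<gamma> s)) has_derivative (\<lambda>s. D' (s *\<^sub>R (R ** (2 *\<^sub>R W))))) (at 0)"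
    if "(f has_derivative D') (at R within SO3)" for D'
  proof (rule has_derivative_in_compose[OF \<gamma>'])
    show "(f has_derivative D') (at (\<gamma> 0) within \<gamma> ` UNIV)"
      unfolding \<gamma>0 by (rule has_derivative_subset[OF that]) (auto simp: \<gamma>_def intro: SO3_mult R rodrigues_SO3)
  qed
  have "D (R ** (2 *\<^sub>R W)) = E (R ** (2 *\<^sub>R W))"
    using fun_cong[OF has_derivative_unique[OF comp[OF D(1)] comp[OF E(1)]], of 1] by simp
  moreover have tan: "R ** (2 *\<^sub>R W) \<in> tangent_SO3 R"
  proof -
    have "transpose (2 *\<^sub>R W) = 2 *\<^sub>R transpose W" by (simp add: transpose_def vec_eq_iff)
    then show ?thesis unfolding W tangent_SO3_def by auto
  qed
  ultimately have "metric_SO3 R G (R ** (2 *\<^sub>R W)) = metric_SO3 R H (R ** (2 *\<^sub>R W))"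
    using D(2) E(2) by simp
  then have "A \<bullet> W = B \<bullet> W" unfolding A(1) B(1) metric by simp
  then have "W \<bullet> W = 0" by (metis W_def inner_diff_left diff_self)
  then show "G = H" by (simp add: W_def A B)
qed

text \<open>The velocity that a unit mass at \<open>B\<close> induces at \<open>A\<close>, namely minus the gradient of the kernel. The formula makes
sense for all matrices but has this meaning only for rotations with \<open>- 1 < A \<bullet> B\<close>.\<close>

definition attraction :: "(real \<Rightarrow> real) \<Rightarrow> real^3^3 \<Rightarrow> real^3^3 \<Rightarrow> real^3^3" where
  "attraction g' A B = kernel_coeff g' (A \<bullet> B) *\<^sub>R (B - A ** transpose B ** A)"

lemma grad_SO3_kernel:
  assumes K: "\<And>R Q. R \<in> SO3 \<Longrightarrow> Q \<in> SO3 \<Longrightarrow> K R Q = g ((geodist R Q)\<^sup>2)"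
    and g: "\<And>s. 0 \<le> s \<Longrightarrow> (g has_real_derivative g' s) (at s within {0..})"
    and R: "R \<in> SO3" and Q: "Q \<in> SO3" and RQ: "- 1 < R \<bullet> Q"
  shows "grad_SO3 (\<lambda>R'. K R' Q) R = - attraction g' R Q"
proof -
  let ?c = "kernel_coeff g' (R \<bullet> Q)" and ?M = "transpose R ** Q"
  have tM: "transpose ?M = transpose Q ** R" by (simp add: matrix_transpose_mul)
  have eq: "- attraction g' R Q = R ** (- ?c *\<^sub>R (?M - transpose ?M))"
  proof -
    interpret bounded_bilinear "(**) :: real^3^3 \<Rightarrow> real^3^3 \<Rightarrow> real^3^3" by (rule bounded_bilinear_matrix_mult)
    show ?thesis
      by (simp add: attraction_def tM scaleR_right diff_right minus_right matrix_mul_assoc SO3_inverse[OF R])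
  qed
  have "is_grad_SO3 (\<lambda>R'. K R' Q) R (- attraction g' R Q)"
    unfolding is_grad_SO3_def
  proof (intro conjI exI ballI)
    show "- attraction g' R Q \<in> tangent_SO3 R"
      unfolding tangent_SO3_def eq
      by (rule CollectI, intro exI[of _ "- ?c *\<^sub>R (?M - transpose ?M)"] conjI refl)
        (simp add: transpose_def vec_eq_iff algebra_simps)
    have "((\<lambda>R'. R' \<bullet> Q) has_derivative (\<lambda>V. V \<bullet> Q)) (at R within SO3)"
      by (auto intro!: derivative_eq_intros)
    moreover have "((\<lambda>x. g ((arccos ((x - 1) / 2))\<^sup>2)) has_derivative (*) (- ?c))
        (at (R \<bullet> Q) within (\<lambda>R'. R' \<bullet> Q) ` SO3)"
      using kernel_profile_has_derivative[where g=g and g'=g', OF g RQ SO3_inner_bounds(2)[OF R Q]]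
      unfolding has_field_derivative_def
      by (rule has_derivative_subset) (use SO3_inner_bounds Q in auto)
    ultimately have "((\<lambda>R'. g ((arccos ((R' \<bullet> Q - 1) / 2))\<^sup>2)) has_derivative (\<lambda>V. - ?c * (V \<bullet> Q))) (at R within SO3)"
      by (rule has_derivative_in_compose)
    then show "((\<lambda>R'. K R' Q) has_derivative (\<lambda>V. - ?c * (V \<bullet> Q))) (at R within SO3)"
      by (rule has_derivative_transform[rotated 2]) (simp_all add: R K Q geodist_eq)
    fix V assume "V \<in> tangent_SO3 R"
    then obtain A where A: "V = R ** A" "transpose A = - A" by (auto simp: tangent_SO3_def)
    have 1: "?M \<bullet> A = V \<bullet> Q" unfolding A(1) transpose_mult_inner by (rule inner_commute)
    have 2: "transpose ?M \<bullet> A = - (V \<bullet> Q)"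
    proof -
      have "transpose ?M \<bullet> transpose (transpose A) = ?M \<bullet> transpose A" by (rule inner_transpose)
      then have "transpose ?M \<bullet> A = ?M \<bullet> (- A)" unfolding transpose_transpose A(2)[symmetric] .
      then show ?thesis by (simp add: 1)
    qed
    show "metric_SO3 R (- attraction g' R Q) V = - ?c * (V \<bullet> Q)"
      unfolding metric_SO3_def eq A(1) matrix_mul_assoc SO3_inverse(1)[OF R] matrix_mul_lid
      by (simp only: inner_scaleR_left inner_diff_left 1 2) (simp add: A)
  qed
  then show ?thesis
    unfolding grad_SO3_def using is_grad_SO3_unique[OF R] by (intro the_equality) auto
qed

section \<open>A globally Lipschitz extension of the interaction\<close>

text \<open>The radial projection onto the ball of radius \<open>2\<close>; this ball contains \<open>SO3\<close>, whose elements have the norm \<open>sqrt 3\<close>.\<close>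

definition radial_trunc :: "'a::real_normed_vector \<Rightarrow> 'a" where
  "radial_trunc x = (2 / max 2 (norm x)) *\<^sub>R x"

lemma radial_trunc_id: "norm x \<le> 2 \<Longrightarrow> radial_trunc x = x"
  by (simp add: radial_trunc_def max_def)

lemma norm_radial_trunc: "norm (radial_trunc x) \<le> 2"
  by (simp add: radial_trunc_def field_simps max_def)

lemma bdd_lipschitz_on_radial_trunc: "bdd_lipschitz_on UNIV radial_trunc"
proof (rule bdd_lipschitz_onI[OF norm_radial_trunc])
  fix x y :: 'a
  let ?m = "\<lambda>x::'a. max 2 (norm x)"
  have "radial_trunc x - radial_trunc y = (2 / ?m x) *\<^sub>R (x - y) + (2 / ?m x - 2 / ?m y) *\<^sub>R y"
    by (simp add: radial_trunc_def algebra_simps)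
  also have "norm \<dots> \<le> norm (x - y) + norm (x - y)"
  proof (intro norm_triangle_le add_mono)
    show "norm ((2 / ?m x) *\<^sub>R (x - y)) \<le> norm (x - y)"
      unfolding norm_scaleR by (rule mult_left_le_one_le) auto
    have "2 / ?m x - 2 / ?m y = 2 * (?m y - ?m x) / (?m x * ?m y)"
      by (subst diff_frac_eq) auto
    then have "norm ((2 / ?m x - 2 / ?m y) *\<^sub>R y) = (2 / ?m x) * (\<bar>?m y - ?m x\<bar> * (norm y / ?m y))"
      by (simp add: abs_mult del: right_diff_distrib_numeral)
    also have "\<dots> \<le> 1 * (norm (x - y) * 1)"
    proof (intro mult_mono)
      have "\<bar>?m y - ?m x\<bar> \<le> \<bar>norm y - norm x\<bar>" by (auto simp: max_def)
      also have "\<dots> \<le> norm (x - y)" by (metis norm_minus_commute norm_triangle_ineq3)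
      finally show "\<bar>?m y - ?m x\<bar> \<le> norm (x - y)" .
    qed auto
    finally show "norm ((2 / ?m x - 2 / ?m y) *\<^sub>R y) \<le> norm (x - y)" by simp
  qed
  finally show "norm (radial_trunc x - radial_trunc y) \<le> 2 * dist x y" by (simp add: dist_norm)
qed

text \<open>An extension of \<open>attraction\<close> from the pairs of rotations with \<open>A \<bullet> B \<ge> a\<close> to all pairs of
matrices, which is bounded and globally Lipschitz if \<open>- 1 < a \<le> 3\<close> and \<open>g'\<close> is locally Lipschitz: the argument of the coefficient is clamped to \<open>{a..3}\<close>, and the matrices are truncated.
Writing \<open>B - A ** transpose B ** A\<close> as \<open>A\<close> times a skew matrix, as is possible for rotations, ensures that the extension still preserves the orthogonality of \<open>A\<close>.\<close>

definition ext_attraction :: "(real \<Rightarrow> real) \<Rightarrow> real \<Rightarrow> real^3^3 \<Rightarrow> real^3^3 \<Rightarrow> real^3^3" where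
  "ext_attraction g' a A B = kernel_coeff g' (max a (min 3 (radial_trunc A \<bullet> radial_trunc B))) *\<^sub>R
     (radial_trunc A ** (transpose (radial_trunc A) ** radial_trunc B - transpose (radial_trunc B) ** radial_trunc A))"

lemma bounded_linear_transpose: "bounded_linear (transpose :: real^'n^'n \<Rightarrow> real^'n^'n)"
  unfolding linear_conv_bounded_linear[symmetric]
  by (rule linearI) (simp_all add: transpose_def vec_eq_iff)

lemma bdd_lipschitz_on_ext_attraction:
  assumes loc: "local_lipschitz (UNIV :: real set) {0..} (\<lambda>_. g')" and a: "- 1 < a" "a \<le> 3"
  shows "bdd_lipschitz_on UNIV (\<lambda>p. ext_attraction g' a (fst p) (snd p))"
proof -
  have f: "bdd_lipschitz_on UNIV (\<lambda>p :: (real^3^3) \<times> (real^3^3). radial_trunc (fst p))"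
    by (rule bdd_lipschitz_on_compose[OF bdd_lipschitz_on_radial_trunc, where C=1]) (auto simp: dist_fst_le)
  have s: "bdd_lipschitz_on UNIV (\<lambda>p :: (real^3^3) \<times> (real^3^3). radial_trunc (snd p))"
    by (rule bdd_lipschitz_on_compose[OF bdd_lipschitz_on_radial_trunc, where C=1]) (auto simp: dist_snd_le)
  have tb: "bounded_bilinear (\<lambda>(A :: real^3^3) (B :: real^3^3). transpose A ** B)"
    using bounded_bilinear.comp[OF bounded_bilinear_matrix_mult bounded_linear_transpose bounded_linear_ident] by simp
  have c: "bdd_lipschitz_on UNIV (\<lambda>x. kernel_coeff g' (max a (min 3 x)))"
    by (rule bdd_lipschitz_on_compose[OF bdd_lipschitz_on_kernel_coeff[OF loc a], where C=1])
      (use a in \<open>auto simp: dist_real_def max_def min_def\<close>)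
  have "bdd_lipschitz_on UNIV (\<lambda>p :: (real^3^3) \<times> (real^3^3). radial_trunc (fst p) \<bullet> radial_trunc (snd p))"
    by (rule bdd_lipschitz_on_bilinear[OF bounded_bilinear_inner f s])
  then obtain C where C: "\<And>(p :: (real^3^3) \<times> (real^3^3)) (q :: (real^3^3) \<times> (real^3^3)).
      dist (radial_trunc (fst p) \<bullet> radial_trunc (snd p)) (radial_trunc (fst q) \<bullet> radial_trunc (snd q)) \<le> C * dist p q"
    unfolding bdd_lipschitz_on_def dist_norm by blast
  show ?thesis
    unfolding ext_attraction_def
    by (intro bdd_lipschitz_on_bilinear[OF bounded_bilinear_scaleR] bdd_lipschitz_on_diff
        bdd_lipschitz_on_bilinear[OF bounded_bilinear_matrix_mult] bdd_lipschitz_on_bilinear[OF tb] f s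
        bdd_lipschitz_on_compose[OF c _ C]) auto
qed

lemma ext_attraction_bounds:
  assumes loc: "local_lipschitz (UNIV :: real set) {0..} (\<lambda>_. g')" and a: "- 1 < a" "a \<le> 3"
  obtains L where "0 \<le> L" "\<forall>A B. norm (ext_attraction g' a A B) \<le> L"
    "\<forall>A B A' B'. norm (ext_attraction g' a A B - ext_attraction g' a A' B') \<le> L * (norm (A - A') + norm (B - B'))"
    "\<forall>A. continuous_on UNIV (ext_attraction g' a A)"
proof -
  obtain L where L: "0 \<le> L" "\<And>A B. norm (ext_attraction g' a A B) \<le> L"
    "\<And>A B A' B'. norm (ext_attraction g' a A B - ext_attraction g' a A' B') \<le> L * dist (A, B) (A', B')"
    using bdd_lipschitz_on_ext_attraction[OF loc a] unfolding bdd_lipschitz_on_def by fastforce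
  have lip: "norm (ext_attraction g' a A B - ext_attraction g' a A' B') \<le> L * (norm (A - A') + norm (B - B'))" for A B A' B'
  proof -
    have "dist (A, B) (A', B') \<le> norm (A - A') + norm (B - B')"
      by (simp add: dist_norm norm_Pair sqrt_sum_squares_le_sum)
    then show ?thesis using L(3)[of A B A' B'] L(1) by (meson mult_left_mono order_trans)
  qed
  have "continuous_on UNIV (ext_attraction g' a A)" for A
  proof -
    have "L-lipschitz_on UNIV (ext_attraction g' a A)"
      using lip[of A _ A] L(1) by (auto intro!: lipschitz_onI simp: dist_norm)
    then show ?thesis by (rule lipschitz_on_continuous_on)
  qed
  with L lip show thesis by (intro that[of L]) auto
qed

lemma ext_attraction_eq:
  assumes A: "A \<in> SO3" and B: "B \<in> SO3"
  shows "ext_attraction g' a A B = kernel_coeff g' (max a (A \<bullet> B)) *\<^sub>R (B - A ** transpose B ** A)"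
proof -
  interpret bounded_bilinear "(**) :: real^3^3 \<Rightarrow> real^3^3 \<Rightarrow> real^3^3" by (rule bounded_bilinear_matrix_mult)
  have "norm A \<le> 2" "norm B \<le> 2" using SO3_norm A B by (auto intro: real_le_lsqrt)
  then show ?thesis
    using SO3_inner_bounds[OF A B]
    by (simp add: ext_attraction_def radial_trunc_id diff_right matrix_mul_assoc SO3_inverse[OF A] min_absorb2)
qed

text \<open>The defect \<open>E = transpose A ** A - mat 1\<close> of orthogonality evolves by a multiple of the commutator
\<open>E ** W - W ** E\<close> with a skew matrix \<open>W\<close>, and this is orthogonal to \<open>E\<close>.\<close>

lemma ext_attraction_orthogonality_rate:
  "(transpose A ** A - mat 1) \<bullet> (transpose (ext_attraction g' a A B) ** A + transpose A ** ext_attraction g' a A B) = 0"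
proof -
  interpret bounded_bilinear "(**) :: real^3^3 \<Rightarrow> real^3^3 \<Rightarrow> real^3^3" by (rule bounded_bilinear_matrix_mult)
  let ?l = "kernel_coeff g' (max a (min 3 (radial_trunc A \<bullet> radial_trunc B))) * (2 / max 2 (norm A))"
  define W where "W = transpose (radial_trunc A) ** radial_trunc B - transpose (radial_trunc B) ** radial_trunc A"
  define E where "E = transpose A ** A - mat 1"
  have tr_diff: "transpose (X - Y) = transpose X - transpose Y" for X Y :: "real^3^3"
    by (simp add: transpose_def vec_eq_iff)
  have tr_scale: "transpose (c *\<^sub>R X) = c *\<^sub>R transpose X" for c and X :: "real^3^3"
    by (simp add: transpose_def vec_eq_iff)
  have W: "transpose W = - W" by (simp add: W_def tr_diff matrix_transpose_mul)
  have E: "transpose E = E" by (simp add: E_def tr_diff matrix_transpose_mul)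
  have F: "ext_attraction g' a A B = ?l *\<^sub>R (A ** W)"
  proof -
    have "radial_trunc A ** W = (2 / max 2 (norm A)) *\<^sub>R (A ** W)"
      unfolding radial_trunc_def[of A] by (rule scaleR_left)
    then show ?thesis unfolding ext_attraction_def W_def[symmetric] by simp
  qed
  have "transpose (ext_attraction g' a A B) ** A + transpose A ** ext_attraction g' a A B
      = ?l *\<^sub>R (E ** W - W ** E)"
    unfolding F tr_scale matrix_transpose_mul W E_def
    by (simp add: scaleR_left scaleR_right diff_left diff_right matrix_mul_assoc scaleR_add_right
        scaleR_diff_right minus_left)
  moreover have "E \<bullet> (W ** E) = - (E \<bullet> (E ** W))"
  proof -
    have "E \<bullet> (W ** E) = transpose E \<bullet> transpose (W ** E)" by (simp add: inner_transpose)
    also have "\<dots> = - (E \<bullet> (E ** W))" by (simp add: matrix_transpose_mul W E minus_right)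
    finally show ?thesis .
  qed
  moreover have "E \<bullet> (E ** W) = 0"
  proof -
    have "E \<bullet> (E ** W) = (transpose E ** E) \<bullet> W" by (simp add: transpose_mult_inner)
    moreover have "(transpose E ** E) \<bullet> W = transpose (transpose E ** E) \<bullet> transpose W"
      by (simp only: inner_transpose)
    then have "(transpose E ** E) \<bullet> W = - ((transpose E ** E) \<bullet> W)"
      by (simp add: matrix_transpose_mul W E)
    ultimately show ?thesis by simp
  qed
  ultimately show ?thesis unfolding E_def[symmetric] by (simp add: inner_diff_right)
qed

text \<open>The hypothesis on \<open>V\<close> keeps the norm of \<open>transpose A ** A - mat 1\<close> constant; the determinant stays \<open>1\<close> by continuity.\<close>

lemma SO3_invariant:
  assumes init: "A 0 \<in> SO3"
    and A: "\<And>t. 0 \<le> t \<Longrightarrow> (A has_vector_derivative V t) (at t within {0..})"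
    and V: "\<And>t. 0 \<le> t \<Longrightarrow>
      (transpose (A t) ** A t - mat 1) \<bullet> (transpose (V t) ** A t + transpose (A t) ** V t) = 0"
    and t: "0 \<le> t"
  shows "A t \<in> SO3"
proof -
  define E where "E t = transpose (A t) ** A t - mat 1" for t
  have tb: "bounded_bilinear (\<lambda>(A :: real^3^3) (B :: real^3^3). transpose A ** B)"
    using bounded_bilinear.comp[OF bounded_bilinear_matrix_mult bounded_linear_transpose bounded_linear_ident] by simp
  have "\<exists>c. \<forall>t\<in>{0..}. E t \<bullet> E t = c"
  proof (rule has_derivative_zero_constant)
    fix t :: real assume "t \<in> {0..}"
    then have t: "0 \<le> t" by simp
    have "(E has_vector_derivative (transpose (A t) ** V t + transpose (V t) ** A t - 0)) (at t within {0..})"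
      unfolding E_def
      by (intro has_vector_derivative_diff has_vector_derivative_const
          bounded_bilinear.has_vector_derivative[OF tb] A t)
    then have "(E has_derivative (\<lambda>h. h *\<^sub>R (transpose (A t) ** V t + transpose (V t) ** A t))) (at t within {0..})"
      by (simp add: has_vector_derivative_def)
    from has_derivative_inner[OF this this] V[OF t]
    show "((\<lambda>t. E t \<bullet> E t) has_derivative (\<lambda>h. 0)) (at t within {0..})"
      by (simp add: E_def[symmetric] add.commute inner_commute)
  qed auto
  then obtain c where c: "\<And>t. 0 \<le> t \<Longrightarrow> E t \<bullet> E t = c" by auto
  have "E 0 = 0" using init by (simp add: E_def SO3_iff)
  then have "c = 0" using c[of 0] by simp
  then have E0: "E t = 0" if "0 \<le> t" for t using c[OF that] by simp
  then have orth: "orthogonal_matrix (A t)" if "0 \<le> t" for t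
    using that by (simp add: E_def orthogonal_matrix)
  have "continuous_on {0..} A"
    using A unfolding continuous_on_eq_continuous_within by (auto intro: has_vector_derivative_continuous)
  then have cont: "continuous_on {0..t} (\<lambda>s. det (A s))"
    unfolding det_3 by (intro continuous_intros) (auto elim: continuous_on_subset)
  have "det (A t) \<noteq> - 1"
  proof
    assume "det (A t) = - 1"
    then obtain s where "0 \<le> s" "det (A s) = 0"
      using IVT2'[of "\<lambda>s. det (A s)" t 0 0] cont t init by (auto simp: SO3_iff)
    then show False using det_orthogonal_matrix[OF orth[of s]] by auto
  qed
  then have "det (A t) = 1" using det_orthogonal_matrix[OF orth[OF t]] by auto
  then show ?thesis using E0[OF t] by (simp add: SO3_iff E_def)
qed

section \<open>Invariance of the closed geodesic ball\<close>

lemma abs_trace_le: "\<bar>trace X\<bar> \<le> 2 * norm (X :: real^3^3)"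
proof -
  have "norm (mat 1 :: real^3^3) = sqrt 3" by (rule SO3_norm) (simp add: SO3_iff)
  then have "norm (mat 1 :: real^3^3) \<le> 2" by (simp add: real_le_lsqrt)
  then have "norm (mat 1 :: real^3^3) * norm X \<le> 2 * norm X" by (rule mult_right_mono) simp
  then show ?thesis
    unfolding trace_eq_inner_mat1 using Cauchy_Schwarz_ineq2[of "mat 1" X] by linarith
qed

text \<open>If one of the traces is at most \<open>1\<close>, then the comparison of traces is not available, but \<open>b \<ge> k - 1\<close> and the bound
\<open>L\<close> on the field suffices.\<close>

lemma trace_ext_attraction_lower_bound:
  assumes AB: "A \<in> SO3" "B \<in> SO3" and k: "1 < k" "trace A \<le> k"
    and b: "k - b \<le> trace A" "k - b \<le> trace B" "0 \<le> b"
    and c: "0 \<le> kernel_coeff g' (max a (A \<bullet> B))" "kernel_coeff g' (max a (A \<bullet> B)) \<le> M"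
    and L: "norm (ext_attraction g' a A B) \<le> L"
  shows "- ((4 * M + 2 * L / (k - 1)) * b) \<le> trace (ext_attraction g' a A B)"
proof (cases "1 < trace A \<and> 1 < trace B")
  case True
  let ?c = "kernel_coeff g' (max a (A \<bullet> B))"
  have "- (4 * M * b) \<le> - (4 * ?c * b)" using c b(3) by (simp add: mult_right_mono)
  also have "\<dots> \<le> ?c * (- 4 * max 0 (trace A - trace B))"
  proof -
    have "?c * max 0 (trace A - trace B) \<le> ?c * b" using b k c by (intro mult_left_mono) auto
    then show ?thesis by (simp add: mult.left_commute[of ?c])
  qed
  also have "\<dots> \<le> ?c * trace (B - A ** transpose B ** A)"
    using trace_attraction_lower_bound[OF AB] True c by (intro mult_left_mono) auto
  also have "\<dots> = trace (ext_attraction g' a A B)"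
    unfolding ext_attraction_eq[OF AB] by (simp add: trace_def sum_distrib_left)
  finally have "- (4 * M * b) \<le> trace (ext_attraction g' a A B)" .
  moreover have "0 \<le> 2 * L / (k - 1) * b"
    using L norm_ge_zero[of "ext_attraction g' a A B"] k b by (intro mult_nonneg_nonneg divide_nonneg_nonneg) linarith+
  ultimately show ?thesis by (simp add: algebra_simps)
next
  case False
  then have "k - 1 \<le> b" using b by auto
  moreover have L0: "0 \<le> L" using L norm_ge_zero order_trans by blast
  ultimately have "2 * L * (k - 1) \<le> 2 * L * b" by (intro mult_left_mono) auto
  then have "2 * L \<le> 2 * L / (k - 1) * b" using k by (simp add: field_simps)
  moreover have "0 \<le> 4 * M * b" using c b by (intro mult_nonneg_nonneg) auto
  moreover have "- (2 * L) \<le> trace (ext_attraction g' a A B)" using abs_trace_le[of "ext_attraction g' a A B"] L by linarith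
  ultimately show ?thesis by (simp add: algebra_simps)
qed

text \<open>For \<open>k = 1 + 2 * cos r\<close> the set \<open>{Q \<in> SO3. k \<le> trace Q}\<close> is a closed geodesic ball about the identity of radius \<open>r\<close>, and \<open>1 < k\<close> means that
\<open>r < pi / 2\<close>.\<close>

lemma invariant_flow_exists:
  fixes \<mu> :: "(real^3^3) measure"
  assumes \<mu>: "prob_space \<mu>"
    and meas: "\<And>f :: real^3^3 \<Rightarrow> real^3^3. continuous_on UNIV f \<Longrightarrow> f \<in> borel_measurable \<mu>"
    and sp: "space \<mu> \<subseteq> {Q \<in> SO3. k \<le> trace Q}" and k: "1 < k"
    and loc: "local_lipschitz (UNIV :: real set) {0..} (\<lambda>_. g')"
    and nonneg: "\<And>s. 0 \<le> s \<Longrightarrow> 0 \<le> g' s" and a: "- 1 < a" "a \<le> 3"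
  obtains \<Psi> where "\<forall>t. continuous_on UNIV (\<Psi> t)" "\<forall>R\<in>space \<mu>. \<Psi> 0 R = R"
    "\<forall>t\<ge>0. \<forall>R\<in>space \<mu>. \<Psi> t R \<in> {Q \<in> SO3. k \<le> trace Q}"
    "\<forall>t\<ge>0. \<forall>R\<in>space \<mu>.
      ((\<lambda>s. \<Psi> s R) has_vector_derivative (LINT S|\<mu>. ext_attraction g' a (\<Psi> t R) (\<Psi> t S))) (at t within {0..})"
proof -
  interpret prob_space \<mu> by fact
  obtain L where L': "0 \<le> L" "\<forall>A B. norm (ext_attraction g' a A B) \<le> L"
    "\<forall>A B A' B'. norm (ext_attraction g' a A B - ext_attraction g' a A' B') \<le> L * (norm (A - A') + norm (B - B'))"
    "\<forall>A. continuous_on UNIV (ext_attraction g' a A)"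
    by (rule ext_attraction_bounds[OF loc a])
  note L = L'(1) L'(2)[rule_format] and lip = L'(3)[rule_format] and cont = L'(4)[rule_format]
  obtain M where M: "\<And>x. x \<in> {a..3} \<Longrightarrow> norm (kernel_coeff g' x) \<le> M"
    using bdd_lipschitz_on_kernel_coeff[OF loc a] unfolding bdd_lipschitz_on_def by blast
  have tcont: "continuous_on UNIV (radial_trunc :: real^3^3 \<Rightarrow> real^3^3)"
  proof -
    obtain C where "0 \<le> C" "\<And>x y :: real^3^3. norm (radial_trunc x - radial_trunc y) \<le> C * dist x y"
      using bdd_lipschitz_on_radial_trunc unfolding bdd_lipschitz_on_def by blast
    then have "C-lipschitz_on UNIV (radial_trunc :: real^3^3 \<Rightarrow> real^3^3)" by (auto intro!: lipschitz_onI simp: dist_norm)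
    then show ?thesis by (rule lipschitz_on_continuous_on)
  qed
  have tbd: "bounded (range (radial_trunc :: real^3^3 \<Rightarrow> real^3^3))"
    unfolding bounded_iff using norm_radial_trunc by blast
  obtain \<Psi> where \<Psi>: "\<Psi> 0 = radial_trunc" "\<And>t. continuous_on UNIV (\<Psi> t)"
    "\<And>t R. 0 \<le> t \<Longrightarrow> ((\<lambda>s. \<Psi> s R) has_vector_derivative (LINT S|\<mu>. ext_attraction g' a (\<Psi> t R) (\<Psi> t S)))
       (at t within {0..})"
    using mean_field_flow_exists[OF \<mu> meas L(2) lip L(1) tcont tbd] by metis
  have init: "\<Psi> 0 R = R" if "R \<in> space \<mu>" for R
  proof -
    have "norm R = sqrt 3" using that sp by (auto intro: SO3_norm)
    then have "norm R \<le> 2" by (simp add: real_le_lsqrt)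
    then show ?thesis by (simp add: \<Psi>(1) radial_trunc_id)
  qed
  have int: "integrable \<mu> (\<lambda>S. ext_attraction g' a A (\<Psi> t S))" for A t
  proof (rule integrable_const_bound[where B=L])
    show "(\<lambda>S. ext_attraction g' a A (\<Psi> t S)) \<in> borel_measurable \<mu>"
      by (intro meas continuous_on_compose2[OF cont \<Psi>(2)]) auto
  qed (use L in auto)
  have SO3: "\<Psi> t R \<in> SO3" if R: "R \<in> space \<mu>" and t: "0 \<le> t" for R t
  proof (rule SO3_invariant[OF _ \<Psi>(3)])
    show "\<Psi> 0 R \<in> SO3" using R sp init by auto
    fix t :: real assume "0 \<le> t"
    let ?E = "transpose (\<Psi> t R) ** \<Psi> t R - mat 1"
    have "bounded_linear (\<lambda>V. ?E \<bullet> (transpose V ** \<Psi> t R + transpose (\<Psi> t R) ** V))"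
      by (intro bounded_linear_compose[OF bounded_linear_inner_right] bounded_linear_add
          bounded_linear_compose[OF bounded_bilinear.bounded_linear_left[OF bounded_bilinear_matrix_mult] bounded_linear_transpose]
          bounded_bilinear.bounded_linear_right[OF bounded_bilinear_matrix_mult])
    from integral_bounded_linear[OF this int[of "\<Psi> t R" t]]
    show "?E \<bullet> (transpose (LINT S|\<mu>. ext_attraction g' a (\<Psi> t R) (\<Psi> t S)) ** \<Psi> t R
        + transpose (\<Psi> t R) ** (LINT S|\<mu>. ext_attraction g' a (\<Psi> t R) (\<Psi> t S))) = 0"
      by (simp add: ext_attraction_orthogonality_rate)
  qed (use t in auto)
  have tr_int: "trace (LINT S|\<mu>. ext_attraction g' a A (\<Psi> t S)) = (LINT S|\<mu>. trace (ext_attraction g' a A (\<Psi> t S)))" for A t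
    unfolding trace_eq_inner_mat1 by (rule integral_bounded_linear[OF bounded_linear_inner_right int, symmetric])
  have tr: "k \<le> trace (\<Psi> t R)" if R: "R \<in> space \<mu>" and t: "0 \<le> t" for R t
  proof (rule family_barrier[where I="space \<mu>" and p="\<lambda>R t. trace (\<Psi> t R)" and M="k + 1"
        and C="4 * M + 2 * L / (k - 1)"
        and p'="\<lambda>R t. trace (LINT S|\<mu>. ext_attraction g' a (\<Psi> t R) (\<Psi> t S))"])
    have "0 \<le> M" using M[of a] a norm_ge_zero order_trans by (metis atLeastAtMost_iff order_refl)
    then show "0 \<le> 4 * M + 2 * L / (k - 1)" using L(1) k by simp
    show "0 \<le> k + 1" using k by simp
    fix R and t :: real assume R: "R \<in> space \<mu>" and t: "0 \<le> t"
    show "k - (k + 1) \<le> trace (\<Psi> t R)" using SO3_trace_bounds[OF SO3[OF R t]] by simp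
    show "((\<lambda>t. trace (\<Psi> t R)) has_real_derivative trace (LINT S|\<mu>. ext_attraction g' a (\<Psi> t R) (\<Psi> t S))) (at t within {0..})"
      unfolding trace_eq_inner_mat1 has_real_derivative_iff_has_vector_derivative
      by (rule bounded_linear.has_vector_derivative[OF bounded_linear_inner_right \<Psi>(3)[OF t]])
    fix B :: real assume B: "0 \<le> B" "trace (\<Psi> t R) \<le> k" "\<And>S. S \<in> space \<mu> \<Longrightarrow> k - B \<le> trace (\<Psi> t S)"
    have "- ((4 * M + 2 * L / (k - 1)) * B) = (LINT S|\<mu>. - ((4 * M + 2 * L / (k - 1)) * B))"
      by (simp add: prob_space)
    also have "\<dots> \<le> (LINT S|\<mu>. trace (ext_attraction g' a (\<Psi> t R) (\<Psi> t S)))"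
    proof (rule integral_mono)
      show "integrable \<mu> (\<lambda>S. trace (ext_attraction g' a (\<Psi> t R) (\<Psi> t S)))"
        unfolding trace_eq_inner_mat1 by (intro integrable_inner_right int)
      fix S assume S: "S \<in> space \<mu>"
      have "max a (\<Psi> t R \<bullet> \<Psi> t S) \<in> {a..3}"
        using SO3_inner_bounds[OF SO3[OF R t] SO3[OF S t]] a by auto
      then show "- ((4 * M + 2 * L / (k - 1)) * B) \<le> trace (ext_attraction g' a (\<Psi> t R) (\<Psi> t S))"
        using M[of "max a (\<Psi> t R \<bullet> \<Psi> t S)"] a
        by (intro trace_ext_attraction_lower_bound SO3 R S t k B L(2) kernel_coeff_nonneg nonneg) auto
    qed simp
    also have "\<dots> = trace (LINT S|\<mu>. ext_attraction g' a (\<Psi> t R) (\<Psi> t S))" by (rule tr_int[symmetric])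
    finally show "- ((4 * M + 2 * L / (k - 1)) * B) \<le> trace (LINT S|\<mu>. ext_attraction g' a (\<Psi> t R) (\<Psi> t S))" .
  qed (use R t sp init in auto)
  show thesis
    using \<Psi>(2,3) init SO3 tr by (intro that[of \<Psi>]) auto
qed

section \<open>Supports of measures\<close>

text \<open>The complement of the support is a union of null open sets; by the Lindelof property countably many of them suffice.\<close>

lemma msupp_measurable_full:
  assumes \<rho>: "\<rho> \<in> prob_measures U"
  shows "msupp \<rho> \<in> sets \<rho>" "emeasure \<rho> (msupp \<rho>) = 1"
proof -
  have sets: "sets \<rho> = sets (restrict_space borel U)" and "prob_space \<rho>"
    using \<rho> by (auto simp: prob_measures_def)
  interpret prob_space \<rho> by fact
  have space: "space \<rho> = U" using sets_eq_imp_space_eq[OF sets] by (simp add: space_restrict_space)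
  have open_sets: "V \<inter> space \<rho> \<in> sets \<rho>" if "open V" for V
    using that unfolding sets space by (auto simp: sets_restrict_space Int_commute)
  define \<F> where "\<F> = {V. open V \<and> emeasure \<rho> (V \<inter> space \<rho>) = 0}"
  have eq: "msupp \<rho> = space \<rho> - (\<Union>\<F> \<inter> space \<rho>)"
    by (auto simp: msupp_def \<F>_def zero_less_iff_neq_zero)
  obtain \<G> where \<G>: "\<G> \<subseteq> \<F>" "countable \<G>" "\<Union>\<G> = \<Union>\<F>"
    using Lindelof[of \<F>] by (auto simp: \<F>_def)
  have "(\<Union>V\<in>\<G>. V \<inter> space \<rho>) \<in> null_sets \<rho>"
    using \<G> by (intro null_sets_UN') (auto simp: \<F>_def null_sets_def intro: open_sets)
  moreover have "(\<Union>V\<in>\<G>. V \<inter> space \<rho>) = \<Union>\<F> \<inter> space \<rho>" using \<G>(3) by auto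
  ultimately have null: "\<Union>\<F> \<inter> space \<rho> \<in> null_sets \<rho>" by simp
  then show "msupp \<rho> \<in> sets \<rho>" unfolding eq by (intro sets.Diff) auto
  show "emeasure \<rho> (msupp \<rho>) = 1"
    unfolding eq using emeasure_Diff_null_set[OF null sets.top] by (simp add: emeasure_space_1)
qed

lemma msupp_distr_subset:
  assumes f: "f \<in> measurable \<mu> (restrict_space borel U)" and C: "closed C" "f ` space \<mu> \<subseteq> C"
  shows "msupp (distr \<mu> (restrict_space borel U) f) \<subseteq> C"
proof
  fix x assume x: "x \<in> msupp (distr \<mu> (restrict_space borel U) f)"
  show "x \<in> C"
  proof (rule ccontr)
    assume "x \<notin> C"
    then have "0 < emeasure (distr \<mu> (restrict_space borel U) f) (- C \<inter> space (distr \<mu> (restrict_space borel U) f))"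
      using x C(1) unfolding msupp_def by (blast intro: open_Compl)
    moreover have "- C \<inter> U \<in> sets (restrict_space borel U)"
      using C(1) by (auto simp: sets_restrict_space Int_commute)
    moreover have "f -` (- C \<inter> U) \<inter> space \<mu> = {}" using C(2) by auto
    ultimately show False using f by (simp add: emeasure_distr space_restrict_space)
  qed
qed

lemma time_interval_infinity: "time_interval \<infinity> = {0..}"
  by (auto simp: time_interval_def)

section \<open>Well-posedness of the aggregation model\<close>

theorem proposition5p1:
  fixes K :: "real^3^3 \<Rightarrow> real^3^3 \<Rightarrow> real"
    and g g' :: "real \<Rightarrow> real"
    and \<epsilon> r :: real
    and \<rho>0 :: "(real^3^3) measure"
  assumes "0 < \<epsilon>" and "\<epsilon> < pi / 2"
    and "\<And>R Q. R \<in> SO3 \<Longrightarrow> Q \<in> SO3 \<Longrightarrow> K R Q = g ((geodist R Q)\<^sup>2)"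
    and "\<And>s. 0 \<le> s \<Longrightarrow> (g has_real_derivative g' s) (at s within {0..})"
    and "local_lipschitz (UNIV :: real set) {0..} (\<lambda>_. g')"
    and "\<And>s. 0 \<le> s \<Longrightarrow> 0 \<le> g' s"
    and "\<rho>0 \<in> prob_measures (geoball (pi / 2 - \<epsilon>))"
    and "0 < r" and "r < pi / 2 - \<epsilon>"
    and "msupp \<rho>0 \<subseteq> closure (geoball r)"
  shows "\<exists>\<rho>. \<rho> \<in> narrow_curves \<infinity> (geoball (pi / 2 - \<epsilon>)) \<and>
      weak_solution K (geoball (pi / 2 - \<epsilon>)) \<infinity> \<rho>0 \<rho> \<and>
      (\<forall>\<sigma>. \<sigma> \<in> narrow_curves \<infinity> (geoball (pi / 2 - \<epsilon>)) \<and>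
           weak_solution K (geoball (pi / 2 - \<epsilon>)) \<infinity> \<rho>0 \<sigma> \<longrightarrow>
           (\<forall>t\<ge>0. \<sigma> t = \<rho> t)) \<and>
      (\<forall>t\<ge>0. msupp (\<rho> t) \<subseteq> closure (geoball r))"
proof -
  define U where "U = geoball (pi / 2 - \<epsilon>)"
  define s where "s = sin \<epsilon>"
  define k where "k = 1 + 2 * cos r"
  define a where "a = 4 * s\<^sup>2 - 1"
  define \<Sigma> where "\<Sigma> = msupp \<rho>0"
  define \<mu> where "\<mu> = restrict_space \<rho>0 \<Sigma>"
  have s: "0 < s" "s \<le> 1" using assms(1,2) by (auto simp: s_def sin_gt_zero)
  have a: "- 1 < a" "a \<le> 3" using s by (auto simp: a_def power_le_one)
  have k1: "1 < k" using cos_gt_zero[of r] assms(1,8,9) by (simp add: k_def)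
  have U_eq: "U = {Q \<in> SO3. 1 + 2 * s < trace Q}"
    unfolding U_def s_def using assms(1,2)
    by (subst geoball_eq) (auto simp: cos_diff)
  have C_eq: "closure (geoball r) = {Q \<in> SO3. k \<le> trace Q}"
    unfolding k_def using assms(1,8,9) by (intro closure_geoball_eq) auto
  have C_U: "closure (geoball r) \<subseteq> U"
  proof -
    have "cos (pi / 2 - \<epsilon>) < cos r" using assms(1,2,8,9) by (intro cos_monotone_0_pi) auto
    then have "s < cos r" by (simp add: s_def cos_diff)
    then show ?thesis unfolding C_eq U_eq k_def by auto
  qed
  have U_SO3: "R \<in> SO3" if "R \<in> U" for R using that by (simp add: U_eq)
  \<comment> \<open>On the ball \<open>U\<close> the extended interaction agrees with the original one, since \<open>a\<close> bounds \<open>R \<bullet> Q\<close> from below there.\<close>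
  have U_inner: "a \<le> R \<bullet> Q" if "R \<in> U" "Q \<in> U" for R Q
    using that SO3_inner_lower_bound[OF _ _ s(1), of R Q] by (auto simp: U_eq a_def)
  have \<rho>0: "\<rho>0 \<in> prob_measures U" using assms(7) by (simp add: U_def)
  then have sets0: "sets \<rho>0 = sets (restrict_space borel U)" and "prob_space \<rho>0"
    by (auto simp: prob_measures_def)
  have space0: "space \<rho>0 = U" using sets_eq_imp_space_eq[OF sets0] by (simp add: space_restrict_space)
  note \<Sigma> = msupp_measurable_full[OF \<rho>0, folded \<Sigma>_def]
  have \<mu>_space: "space \<mu> = \<Sigma>"
    using sets.sets_into_space[OF \<Sigma>(1)] by (auto simp: \<mu>_def space_restrict_space)
  have prob\<mu>: "prob_space \<mu>" unfolding \<mu>_def by (rule prob_space_restrict_space[OF \<Sigma>])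
  interpret prob_space \<mu> by (rule prob\<mu>)
  have \<Sigma>_C: "\<Sigma> \<subseteq> closure (geoball r)" using assms(10) by (simp add: \<Sigma>_def)
  have meas: "f \<in> measurable \<mu> N" if "f \<in> measurable borel N" for f and N :: "'b measure"
  proof -
    have "f \<in> measurable \<rho>0 N"
      unfolding measurable_cong_sets[OF sets0 refl] by (rule measurable_restrict_space1[OF that])
    then show ?thesis unfolding \<mu>_def by (rule measurable_restrict_space1)
  qed
  note loc = assms(5) and nonneg = assms(6)
  obtain L where L': "0 \<le> L" "\<forall>A B. norm (ext_attraction g' a A B) \<le> L"
    "\<forall>A B A' B'. norm (ext_attraction g' a A B - ext_attraction g' a A' B') \<le> L * (norm (A - A') + norm (B - B'))"
    "\<forall>A. continuous_on UNIV (ext_attraction g' a A)"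
    by (rule ext_attraction_bounds[OF loc a])
  note L = L'(1) L'(2)[rule_format] and lip = L'(3)[rule_format] and cont = L'(4)[rule_format]
  have tmeas: "ext_attraction g' a A \<in> borel_measurable borel" for A
    by (intro borel_measurable_continuous_onI cont)
  have into_borel: "\<Phi> \<in> borel_measurable \<mu>" if "\<Phi> \<in> measurable \<mu> (restrict_space borel U)" for \<Phi>
    using that by (simp add: measurable_restrict_space2_iff)
  have int: "integrable \<mu> (\<lambda>S. ext_attraction g' a A (\<Phi> S))"
    if "\<Phi> \<in> measurable \<mu> (restrict_space borel U)" for A \<Phi>
    using L measurable_compose[OF into_borel[OF that] tmeas]
    by (intro integrable_const_bound[where B=L]) auto
  \<comment> \<open>For a pushed-forward measure the velocity is the right-hand side of the coupled system.\<close>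
  have vel: "velocity K \<sigma> t R = (LINT S|\<mu>. ext_attraction g' a R (\<Phi> S))"
    if \<Phi>: "\<Phi> \<in> measurable \<mu> (restrict_space borel U)"
      and \<sigma>: "\<sigma> t = distr \<mu> (restrict_space borel U) \<Phi>" and R: "R \<in> U" for \<Phi> \<sigma> t R
  proof -
    have "velocity K \<sigma> t R = - (LINT Q|\<sigma> t. - ext_attraction g' a R Q)"
      unfolding velocity_def
    proof (intro arg_cong[of _ _ uminus] Bochner_Integration.integral_cong refl)
      fix Q assume "Q \<in> space (\<sigma> t)"
      then have Q: "Q \<in> U" by (simp add: \<sigma> space_restrict_space)
      have "grad_SO3 (\<lambda>R'. K R' Q) R = - attraction g' R Q"
        using U_inner[OF R Q] a U_SO3[OF R] U_SO3[OF Q] assms(3,4)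
        by (intro grad_SO3_kernel[where g=g]) auto
      also have "attraction g' R Q = ext_attraction g' a R Q"
        using U_inner[OF R Q] by (simp add: attraction_def ext_attraction_eq[OF U_SO3[OF R] U_SO3[OF Q]] max_absorb2)
      finally show "grad_SO3 (\<lambda>R'. K R' Q) R = - ext_attraction g' a R Q" .
    qed
    also have "\<dots> = (LINT Q|\<sigma> t. ext_attraction g' a R Q)" by simp
    also have "\<dots> = (LINT S|\<mu>. ext_attraction g' a R (\<Phi> S))"
      unfolding \<sigma> by (rule integral_distr[OF \<Phi> measurable_restrict_space1[OF tmeas]])
    finally show ?thesis .
  qed
  have meas_cont: "f \<in> borel_measurable \<mu>" if "continuous_on UNIV f" for f :: "real^3^3 \<Rightarrow> real^3^3"
    by (intro meas borel_measurable_continuous_onI that)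
  have \<mu>_SO3: "space \<mu> \<subseteq> {Q \<in> SO3. k \<le> trace Q}" using \<Sigma>_C by (simp add: \<mu>_space C_eq)
  obtain \<Psi> where \<Psi>': "\<forall>t. continuous_on UNIV (\<Psi> t)" "\<forall>R\<in>space \<mu>. \<Psi> 0 R = R"
    "\<forall>t\<ge>0. \<forall>R\<in>space \<mu>. \<Psi> t R \<in> {Q \<in> SO3. k \<le> trace Q}"
    "\<forall>t\<ge>0. \<forall>R\<in>space \<mu>.
      ((\<lambda>s. \<Psi> s R) has_vector_derivative (LINT S|\<mu>. ext_attraction g' a (\<Psi> t R) (\<Psi> t S))) (at t within {0..})"
    by (rule invariant_flow_exists[OF prob\<mu> meas_cont \<mu>_SO3 k1 loc nonneg a])
  note \<Psi> = \<Psi>'[rule_format]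
  note \<Psi>_C = \<Psi>(3)[folded C_eq]
  have \<Psi>_U: "\<Psi> t R \<in> U" if "0 \<le> t" "R \<in> space \<mu>" for t R using \<Psi>_C[OF that] C_U by auto
  have \<Psi>_meas: "\<Psi> t \<in> measurable \<mu> (restrict_space borel U)" if "0 \<le> t" for t
    using \<Psi>_U[OF that] by (intro measurable_restrict_space2 meas borel_measurable_continuous_onI \<Psi>(1)) auto
  define \<rho> where "\<rho> t = distr \<mu> (restrict_space borel U) (\<Psi> t)" for t
  have \<rho>_prob: "\<rho> t \<in> prob_measures U" if "0 \<le> t" for t
    using prob_space_distr[OF \<Psi>_meas[OF that]] by (simp add: prob_measures_def \<rho>_def)
  have vel\<rho>: "velocity K \<rho> t R = (LINT S|\<mu>. ext_attraction g' a R (\<Psi> t S))" if "0 \<le> t" "R \<in> U" for t R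
    using that by (intro vel \<Psi>_meas) (simp_all add: \<rho>_def)
  have flow: "is_flow_map U (velocity K \<rho>) \<Sigma> \<infinity> \<Psi>"
    unfolding is_flow_map_def time_interval_infinity
    using \<Psi>(2) \<Psi>_U \<Psi>(4) by (auto simp: vel\<rho> \<mu>_space)
  have flowD: "\<Phi> 0 R = R" "0 \<le> t \<Longrightarrow> \<Phi> t R \<in> U"
    "0 \<le> t \<Longrightarrow> ((\<lambda>s. \<Phi> s R) has_vector_derivative velocity K \<sigma> t (\<Phi> t R)) (at t within {0..})"
    if "is_flow_map U (velocity K \<sigma>) \<Sigma> \<infinity> \<Phi>" "R \<in> \<Sigma>" for \<Phi> \<sigma> R t
    using that unfolding is_flow_map_def time_interval_infinity by auto
  have dist_U: "norm (A - B) \<le> 4" if "A \<in> U" "B \<in> U" for A B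
  proof -
    have "norm A \<le> 2" "norm B \<le> 2" using SO3_norm U_SO3 that by (auto simp: real_le_lsqrt)
    then show ?thesis using norm_triangle_ineq4[of A B] by linarith
  qed
  \<comment> \<open>Here the measures \<open>\<rho> t\<close> are fixed and each trajectory is compared on its own; for another weak solution, below, the measures differ too,
  and the Lipschitz constant doubles.\<close>
  have unique_flow: "\<Phi> t R = \<Psi> t R"
    if \<Phi>: "is_flow_map U (velocity K \<rho>) \<Sigma> \<infinity> \<Phi>" and t: "0 \<le> t" and R: "R \<in> \<Sigma>" for \<Phi> t R
  proof (rule family_ode_unique[where X="\<lambda>R t. \<Phi> t R" and Y="\<lambda>R t. \<Psi> t R" and I=\<Sigma> and C=L and M=4,
        OF L(1) _ _ flowD(3)[OF \<Phi>] flowD(3)[OF flow] _ R t])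
    fix R and t B :: real
    assume R: "R \<in> \<Sigma>" and t: "0 \<le> t" and B: "0 \<le> B" "\<And>S. S \<in> \<Sigma> \<Longrightarrow> norm (\<Phi> t S - \<Psi> t S) \<le> B"
    have "norm (ext_attraction g' a (\<Phi> t R) X - ext_attraction g' a (\<Psi> t R) X) \<le> L * B" for X
      using lip[of "\<Phi> t R" X "\<Psi> t R" X] mult_left_mono[OF B(2)[OF R] L(1)] by simp
    then show "norm (velocity K \<rho> t (\<Phi> t R) - velocity K \<rho> t (\<Psi> t R)) \<le> L * B"
      unfolding vel\<rho>[OF t flowD(2)[OF \<Phi> R t]] vel\<rho>[OF t flowD(2)[OF flow R t]]
      by (intro norm_integral_diff_le int \<Psi>_meas t)
  qed (use dist_U flowD[OF \<Phi>] flowD[OF flow] in auto)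
  have unique_sol: "\<sigma> t = \<rho> t" if \<sigma>: "weak_solution K U \<infinity> \<rho>0 \<sigma>" and t: "0 \<le> t" for \<sigma> t
  proof -
    obtain \<Phi> where \<Phi>: "is_flow_map U (velocity K \<sigma>) \<Sigma> \<infinity> \<Phi>"
      and \<Phi>_meas: "\<And>t. 0 \<le> t \<Longrightarrow> \<Phi> t \<in> measurable \<mu> (restrict_space borel U)"
      and \<sigma>_eq: "\<And>t. 0 \<le> t \<Longrightarrow> \<sigma> t = distr \<mu> (restrict_space borel U) (\<Phi> t)"
      using \<sigma> unfolding weak_solution_def time_interval_infinity \<mu>_def \<Sigma>_def by auto
    have "\<Phi> t R = \<Psi> t R" if R: "R \<in> \<Sigma>" for R
    proof (rule family_ode_unique[where X="\<lambda>R t. \<Phi> t R" and Y="\<lambda>R t. \<Psi> t R" and I=\<Sigma> and C="2 * L" and M=4,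
          OF _ _ _ flowD(3)[OF \<Phi>] flowD(3)[OF flow] _ R t])
      fix R and t B :: real
      assume R: "R \<in> \<Sigma>" and t: "0 \<le> t" and B: "0 \<le> B" "\<And>S. S \<in> \<Sigma> \<Longrightarrow> norm (\<Phi> t S - \<Psi> t S) \<le> B"
      have "norm (ext_attraction g' a (\<Phi> t R) (\<Phi> t S) - ext_attraction g' a (\<Psi> t R) (\<Psi> t S)) \<le> 2 * L * B"
        if "S \<in> space \<mu>" for S
      proof -
        have "L * (norm (\<Phi> t R - \<Psi> t R) + norm (\<Phi> t S - \<Psi> t S)) \<le> L * (B + B)"
          using B(2)[OF R] B(2)[of S] that L(1) by (intro mult_left_mono add_mono) (auto simp: \<mu>_space)
        then show ?thesis using lip[of "\<Phi> t R" "\<Phi> t S" "\<Psi> t R" "\<Psi> t S"] by simp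
      qed
      then show "norm (velocity K \<sigma> t (\<Phi> t R) - velocity K \<rho> t (\<Psi> t R)) \<le> 2 * L * B"
        unfolding vel\<rho>[OF t flowD(2)[OF flow R t]]
          vel[of "\<Phi> t" \<sigma> t, OF \<Phi>_meas[OF t] \<sigma>_eq[OF t] flowD(2)[OF \<Phi> R t]]
        by (intro norm_integral_diff_le int \<Psi>_meas \<Phi>_meas t)
    qed (use dist_U flowD[OF \<Phi>] flowD[OF flow] L(1) in auto)
    then show ?thesis
      unfolding \<sigma>_eq[OF t] \<rho>_def by (intro distr_cong) (auto simp: \<mu>_space)
  qed
  have sol: "weak_solution K U \<infinity> \<rho>0 \<rho>"
    unfolding weak_solution_def time_interval_infinity
    using \<rho>_prob flow unique_flow \<Psi>_meas
    by (intro conjI exI[of _ \<Psi>]) (auto simp: \<mu>_def \<Sigma>_def \<rho>_def)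
  have curve: "\<rho> \<in> narrow_curves \<infinity> U"
    unfolding narrow_curves_def time_interval_infinity
  proof (intro CollectI conjI ballI allI impI)
    fix f :: "real^3^3 \<Rightarrow> real" assume f: "continuous_on U f \<and> bounded (f ` U)"
    then obtain M where M: "\<And>x. x \<in> U \<Longrightarrow> norm (f x) \<le> M" unfolding bounded_iff by blast
    have fm: "f \<in> borel_measurable (restrict_space borel U)"
      using f by (intro borel_measurable_continuous_on_restrict) auto
    have eq: "integral\<^sup>L (\<rho> t) f = (LINT S|\<mu>. f (\<Psi> t S))" if "t \<in> {0..}" for t
      unfolding \<rho>_def by (rule integral_distr[OF \<Psi>_meas fm]) (use that in auto)
    have "continuous_on {0..} (\<lambda>t. LINT S|\<mu>. f (\<Psi> t S))"
      unfolding continuous_on_sequentially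
    proof (intro allI ballI impI)
      fix x :: "nat \<Rightarrow> real" and t assume x: "t \<in> {0..}" "(\<forall>n. x n \<in> {0..}) \<and> x \<longlonglongrightarrow> t"
      have "(\<lambda>n. LINT S|\<mu>. f (\<Psi> (x n) S)) \<longlonglongrightarrow> (LINT S|\<mu>. f (\<Psi> t S))"
      proof (rule integral_dominated_convergence[where w="\<lambda>_. M"])
        show "(\<lambda>S. f (\<Psi> t S)) \<in> borel_measurable \<mu>" "(\<lambda>S. f (\<Psi> (x n) S)) \<in> borel_measurable \<mu>" for n
          using x by (auto intro!: measurable_compose[OF \<Psi>_meas fm])
        show "AE S in \<mu>. norm (f (\<Psi> (x n) S)) \<le> M" for n
          using x by (intro AE_I2 M \<Psi>_U) auto
        show "AE S in \<mu>. (\<lambda>n. f (\<Psi> (x n) S)) \<longlonglongrightarrow> f (\<Psi> t S)"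
        proof (rule AE_I2)
          fix S assume S: "S \<in> space \<mu>"
          have "continuous_on {0..} (\<lambda>t. \<Psi> t S)"
            using \<Psi>(4)[OF _ S] unfolding continuous_on_eq_continuous_within
            by (auto intro: has_vector_derivative_continuous)
          then have "continuous_on {0..} (\<lambda>t. f (\<Psi> t S))"
          proof (rule continuous_on_compose2[rotated])
            show "continuous_on U f" using f by simp
            show "(\<lambda>t. \<Psi> t S) ` {0..} \<subseteq> U" using \<Psi>_U[OF _ S] by auto
          qed
          then have "((\<lambda>t. f (\<Psi> t S)) \<circ> x) \<longlonglongrightarrow> f (\<Psi> t S)"
            using x unfolding continuous_on_sequentially by blast
          then show "(\<lambda>n. f (\<Psi> (x n) S)) \<longlonglongrightarrow> f (\<Psi> t S)" by (simp add: o_def)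
        qed
      qed auto
      then show "((\<lambda>t. LINT S|\<mu>. f (\<Psi> t S)) \<circ> x) \<longlonglongrightarrow> (LINT S|\<mu>. f (\<Psi> t S))" by (simp add: o_def)
    qed
    then show "continuous_on {0..} (\<lambda>t. integral\<^sup>L (\<rho> t) f)"
      by (rule continuous_on_eq) (simp add: eq)
  qed (use \<rho>_prob in auto)
  have "msupp (\<rho> t) \<subseteq> closure (geoball r)" if "0 \<le> t" for t
    unfolding \<rho>_def by (rule msupp_distr_subset[OF \<Psi>_meas[OF that]]) (use \<Psi>_C that in auto)
  with curve sol unique_sol show ?thesis unfolding U_def by blast
qed

end
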